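(* Let $\mathcal{L}$ be a lattice of rank $n$ satisfying $\lambda_1(\mathcal{L})=\lambda_n(\mathcal{L})$, and let $A$ denote the set of all shortest nonzero vectors of $\mathcal{L}$. Then there exists a vector $v\in\mathcal{L}^*$ that uniquely defines a linearly independent chain of length $n$ in $A$ and satisfies $\|v\|\le 5n^{17/2}\cdot\lambda_1(\mathcal{L}^* )$.
   Context: A lattice of rank $n$ is the set of integer combinations of $n$ linearly independent vectors in $\mathbb{R}^m$. Successive minima: $\lambda_i(\mathcal{L})=\inf\{r>0:\mathrm{rank}(\mathrm{span}(\mathcal{L}\cap r\mathcal{B}))\ge i\}$ with $\mathcal{B}$ the unit ball. The dual lattice is $\mathcal{L}^*=\{u\in\mathrm{span}(\mathcal{L}):\langle u,v\rangle\in\mathbb{Z}\ \forall v\in\mathcal{L}\}$. For $A\subseteq\mathbb{R}^m$ and $v\in\mathbb{R}^m$, $v$ uniquely defines a linearly independent chain of length $n$ in $A$ if there are $n$ vectors $x_1,\dots,x_n\in A$ such that for every $1\le j\le n$ the minimum of $\langle v,a\rangle$ over $a\in A\setminus\mathrm{span}(x_1,\dots,x_{j-1})$ is uniquely achieved by $a=x_j$. *)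

theory Defs
  imports "HOL-Analysis.Analysis"
begin

definition lattice_of_rank :: "nat \<Rightarrow> 'a::euclidean_space set \<Rightarrow> bool" where
  "lattice_of_rank n L \<longleftrightarrow>
     (\<exists>B. finite B \<and> card B = n \<and> independent B \<and>
          L = {(\<Sum>b\<in>B. of_int (z b) *\<^sub>R b) | z :: 'a \<Rightarrow> int. True})"

(* The infimum is over the empty set (hence unspecified) when i exceeds the rank of L. *)
definition successive_minimum :: "nat \<Rightarrow> 'a::euclidean_space set \<Rightarrow> real" where
  "successive_minimum i L = Inf {r. r > 0 \<and> dim (span (L \<inter> cball 0 r)) \<ge> i}"

definition dual_lattice :: "'a::euclidean_space set \<Rightarrow> 'a set" where
  "dual_lattice L = {u \<in> span L. \<forall>v\<in>L. u \<bullet> v \<in> \<int>}"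

definition shortest_nonzero_vectors :: "'a::euclidean_space set \<Rightarrow> 'a set" where
  "shortest_nonzero_vectors L =
     {x \<in> L. x \<noteq> 0 \<and> (\<forall>y\<in>L. y \<noteq> 0 \<longrightarrow> norm x \<le> norm y)}"

(* The vectors x 1, ..., x n form the chain; x is irrelevant outside {1..n}. *)
definition uniquely_defines_chain ::
    "'a::euclidean_space \<Rightarrow> nat \<Rightarrow> 'a set \<Rightarrow> bool" where
  "uniquely_defines_chain v n A \<longleftrightarrow>
     (\<exists>x :: nat \<Rightarrow> 'a. \<forall>j\<in>{1..n}.
        x j \<in> A - span (x ` {1..<j}) \<and>
        (\<forall>a \<in> A - span (x ` {1..<j}). a \<noteq> x j \<longrightarrow> v \<bullet> x j < v \<bullet> a))"

end

theory Submission
  imports Defs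
begin

text \<open>
  Give the positions of an ordered basis \<open>x\<^sub>1, \<dots>, x\<^sub>n\<close> of shortest vectors the weights
  \<open>n, n - 1, \<dots>, 1\<close>. If \<open>v\<close> attains its minimum over the weighted sums of all ordered bases
  at a single point, an exchange argument shows that the minimising basis is a chain uniquely
  defined by \<open>v\<close>. Such a \<open>v\<close> is a small nonnegative integer combination of independent
  short dual vectors \<open>w\<^sub>1, \<dots>, w\<^sub>n\<close>: against these the weighted sums have bounded integer
  coordinates, so the isolation lemma applies. The \<open>w\<^sub>i\<close>, of length at most
  \<open>n\<^sup>2 / \<lambda>\<^sub>1(L)\<close>, come from repeatedly taking a shortest dual vector and projecting along it,
  with Minkowski's theorem bounding its length at each step. The bound on \<open>v\<close> follows because
  the shortest vectors span, so that \<open>\<lambda>\<^sub>1(L\<^sup>*) \<ge> 1 / \<lambda>\<^sub>1(L)\<close>.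
\<close>

section \<open>Isolation\<close>

text \<open>A chain is a run of the greedy algorithm for a minimum-weight basis of the matroid of
  \<open>A\<close>, and uniqueness has to hold at each of its n steps, each time outside a different
  subspace. Isolation makes a single minimum unique, so the whole run is packed into one linear
  objective on a finite set of vectors. Only the weighted sum has to be unique, not the ordered
  basis that produces it: every exchange that must be strict changes the sum. The exponent is read
  off from the parameters. A dual vector of length at most n^2 / \<lambda> pairs with a shortest
  vector, of length \<lambda>, to an integer of size at most n^2. The n weights are at most n, so
  the weighted sums have coordinates bounded by K = n^4. Isolation over n coordinates then needs
  coefficients up to 2 n K = 2 n^5, and n terms of length n^2 / \<lambda> give 2 n^8 / \<lambda>,
  which lies below the required bound.\<close>

text \<open>With all weights except \<open>z w\<close> fixed, the \<open>w\<close>-coordinate of a minimiser decreases as \<open>z w\<close>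
  grows. So the values of \<open>z w\<close> for which minimisers disagree at \<open>w\<close> are told apart by the least
  such coordinate, and there are at most \<open>2 K\<close> of them.\<close>

lemma isolation:
  fixes f :: "'p \<Rightarrow> 'w \<Rightarrow> int" and W :: "'w set" and P :: "'p set"
  assumes W: "finite W" and P: "finite P" "P \<noteq> {}"
    and K: "\<forall>p\<in>P. \<forall>w\<in>W. \<bar>f p w\<bar> \<le> int K"
  shows "\<exists>z p. (\<forall>w\<in>W. 0 \<le> z w \<and> z w \<le> int (2 * card W * K)) \<and> p \<in> P \<and>
           (\<forall>q\<in>P. (\<Sum>w\<in>W. z w * f p w) < (\<Sum>w\<in>W. z w * f q w) \<or> (\<forall>w\<in>W. f q w = f p w))"
proof -
  define N where "N = 2 * card W * K"
  define Z where "Z = PiE W (\<lambda>_. {0..int N})"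
  define val where "val = (\<lambda>z p. \<Sum>w\<in>W. z w * f p w)"
  define mn where "mn = (\<lambda>z. {p \<in> P. \<forall>q\<in>P. val z p \<le> val z q})"
  define lo where "lo = (\<lambda>w z. Min ((\<lambda>p. f p w) ` mn z))"
  define Bad where "Bad = (\<lambda>w. {z \<in> Z. \<exists>p\<in>mn z. \<exists>q\<in>mn z. f p w \<noteq> f q w})"
  have fin_mn: "finite (mn z)" for z
    using P by (simp add: mn_def)
  have ne_mn: "mn z \<noteq> {}" for z
  proof -
    have "arg_min_on (val z) P \<in> mn z"
      using P arg_min_if_finite[of P "val z"] arg_min_least[of P _ "val z"]
      by (auto simp: mn_def)
    then show ?thesis by blast
  qed
  have lo_in: "\<exists>p\<in>mn z. f p w = lo w z" for z w
  proof -
    have "lo w z \<in> (\<lambda>p. f p w) ` mn z"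
      unfolding lo_def using fin_mn ne_mn by (intro Min_in) auto
    then show ?thesis by force
  qed
  have lo_le: "lo w z \<le> f p w" if "p \<in> mn z" for z w p
    unfolding lo_def using fin_mn that by (intro Min_le) auto
  have hi: "\<exists>q\<in>mn z. lo w z < f q w" if b: "z \<in> Bad w" for z w
  proof -
    obtain p q where "p \<in> mn z" "q \<in> mn z" "f p w \<noteq> f q w"
      using b unfolding Bad_def by blast
    then show ?thesis using lo_le[of p z w] lo_le[of q z w] by (metis less_le)
  qed
  have finZ: "finite Z" and cardZ: "card Z = (N + 1) ^ card W"
    unfolding Z_def using W by (simp_all add: finite_PiE card_PiE nat_add_distrib)
  have mono: "lo w z' < lo w z"
    if w: "w \<in> W" and b: "z' \<in> Bad w"
      and agree: "\<And>u. u \<in> W - {w} \<Longrightarrow> z u = z' u" and less: "z w < z' w" for w z z'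
  proof -
    obtain p where p: "p \<in> mn z" "f p w = lo w z" using lo_in by blast
    obtain q where q: "q \<in> mn z'" "lo w z' < f q w" using hi[OF b] by blast
    have diff: "val z' r = val z r + (z' w - z w) * f r w" for r
    proof -
      have "(\<Sum>u\<in>W - {w}. z u * f r u) = (\<Sum>u\<in>W - {w}. z' u * f r u)"
        using agree by (intro sum.cong) auto
      then show ?thesis
        unfolding val_def using W w by (simp add: sum.remove[of W w] algebra_simps)
    qed
    \<comment> \<open>The objective at \<open>z'\<close> differs from the one at \<open>z\<close> by
      a multiple of the \<open>w\<close>-coordinate alone, so adding these two optimality
      inequalities cancels everything else.\<close>
    have "val z p \<le> val z q" "val z' q \<le> val z' p"
      using p q by (auto simp: mn_def)
    then have "(z' w - z w) * f q w \<le> (z' w - z w) * f p w"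
      by (simp add: diff)
    then have "f q w \<le> f p w" using less by simp
    then show ?thesis using p q by simp
  qed
  have card_Bad: "card (Bad w) \<le> (N + 1) ^ (card W - 1) * (2 * K)" if w: "w \<in> W" for w
  proof -
    \<comment> \<open>The upper end is open because at a bad \<open>z\<close> some minimiser lies
      strictly above \<open>lo w z\<close>; so 2K values remain instead of 2K + 1.\<close>
    define T where "T = PiE (W - {w}) (\<lambda>_. {0..int N}) \<times> {- int K..<int K}"
    have "inj_on (\<lambda>z. (restrict z (W - {w}), lo w z)) (Bad w)"
    proof (rule inj_onI)
      fix z z' assume z: "z \<in> Bad w" "z' \<in> Bad w"
        and eq: "(restrict z (W - {w}), lo w z) = (restrict z' (W - {w}), lo w z')"
      then have agree: "z u = z' u" if "u \<in> W - {w}" for u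
        by (metis Pair_inject restrict_apply' that)
      have "lo w z = lo w z'" using eq by simp
      then have "\<not> z w < z' w" "\<not> z' w < z w"
        using mono[OF w z(2), of z] mono[OF w z(1), of z'] agree by auto
      then have "z u = z' u" if "u \<in> W" for u
        using agree[of u] that by (cases "u = w") auto
      moreover have "z \<in> Z" "z' \<in> Z" using z by (auto simp: Bad_def)
      ultimately show "z = z'"
        unfolding Z_def by (intro PiE_ext) auto
    qed
    moreover have "(\<lambda>z. (restrict z (W - {w}), lo w z)) ` Bad w \<subseteq> T"
    proof (rule image_subsetI)
      fix z assume z: "z \<in> Bad w"
      then have "restrict z (W - {w}) \<in> PiE (W - {w}) (\<lambda>_. {0..int N})"
        by (auto simp: Bad_def Z_def)
      moreover obtain p where "p \<in> mn z" "f p w = lo w z" using lo_in by blast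
      then have "- int K \<le> lo w z" using K[rule_format, of p w] w by (auto simp: mn_def)
      moreover obtain q where "q \<in> mn z" "lo w z < f q w" using hi[OF z] by blast
      then have "lo w z < int K" using K[rule_format, of q w] w by (auto simp: mn_def)
      ultimately show "(restrict z (W - {w}), lo w z) \<in> T" by (simp add: T_def)
    qed
    moreover have "finite T" using W by (auto simp: T_def intro!: finite_PiE)
    ultimately have "card (Bad w) \<le> card T" by (rule card_inj_on_le)
    also have "card T = (N + 1) ^ (card W - 1) * (2 * K)"
      using W w by (simp add: T_def card_cartesian_product card_PiE nat_add_distrib nat_mult_distrib)
    finally show ?thesis .
  qed
  \<comment> \<open>A union bound; \<open>N\<close> is chosen so that the bad sets add up to at most
    N (N + 1)^(card W - 1), just below (N + 1)^(card W).\<close>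
  have "card (\<Union>w\<in>W. Bad w) < card Z"
  proof (cases "W = {}")
    case False
    then have c: "card W > 0" using W by (simp add: card_gt_0_iff)
    have "card (\<Union>w\<in>W. Bad w) \<le> (\<Sum>w\<in>W. card (Bad w))"
      using W by (rule card_UN_le)
    also have "\<dots> \<le> (\<Sum>w\<in>W. (N + 1) ^ (card W - 1) * (2 * K))"
      by (intro sum_mono card_Bad)
    also have "\<dots> = N * (N + 1) ^ (card W - 1)"
      by (simp add: N_def)
    also have "\<dots> < (N + 1) * (N + 1) ^ (card W - 1)"
      by simp
    also have "\<dots> = card Z"
      using c by (simp add: cardZ flip: power_Suc)
    finally show ?thesis .
  qed (simp add: cardZ)
  moreover have "finite (\<Union>w\<in>W. Bad w)"
    using finZ by (rule finite_subset[rotated]) (auto simp: Bad_def)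
  ultimately have "\<not> Z \<subseteq> (\<Union>w\<in>W. Bad w)"
    using card_mono by (meson linorder_not_le)
  then obtain z where z: "z \<in> Z" "\<And>w. w \<in> W \<Longrightarrow> z \<notin> Bad w"
    by blast
  obtain p where p: "p \<in> mn z" using ne_mn by blast
  have "val z p < val z q \<or> (\<forall>w\<in>W. f q w = f p w)" if q: "q \<in> P" for q
  proof (cases "val z p < val z q")
    case False
    then have "val z q \<le> val z r" if "r \<in> P" for r
      using p that by (auto simp: mn_def intro: order_trans[of "val z q" "val z p"])
    then have "q \<in> mn z" using q by (simp add: mn_def)
    then have "f q w = f p w" if "w \<in> W" for w
      using z(1) z(2)[OF that] p unfolding Bad_def by blast
    then show ?thesis by simp
  qed simp
  moreover have "\<forall>w\<in>W. 0 \<le> z w \<and> z w \<le> int (2 * card W * K)"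
    using z(1) by (auto simp: Z_def N_def PiE_iff simp del: of_nat_mult)
  moreover have "p \<in> P" using p by (simp add: mn_def)
  ultimately show ?thesis unfolding val_def by (intro exI[of _ z] exI[of _ p]) simp
qed

text \<open>A point of \<open>span W\<close> is determined by its inner products with
  \<open>W\<close>, so minimisers with equal coordinates are the same point, and isolating
  coordinates isolates the point.\<close>

lemma isolating_combination:
  fixes P W :: "'a::euclidean_space set"
  assumes W: "finite W" and P: "finite P" "P \<noteq> {}" "P \<subseteq> span W"
    and int: "\<And>p w. p \<in> P \<Longrightarrow> w \<in> W \<Longrightarrow> w \<bullet> p \<in> \<int>"
    and K: "\<And>p w. p \<in> P \<Longrightarrow> w \<in> W \<Longrightarrow> \<bar>w \<bullet> p\<bar> \<le> real K"
  shows "\<exists>z :: 'a \<Rightarrow> int. (\<forall>w\<in>W. 0 \<le> z w \<and> z w \<le> int (2 * card W * K)) \<and>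
           (\<exists>p\<in>P. \<forall>q\<in>P. q \<noteq> p \<longrightarrow>
              (\<Sum>w\<in>W. of_int (z w) *\<^sub>R w) \<bullet> p < (\<Sum>w\<in>W. of_int (z w) *\<^sub>R w) \<bullet> q)"
proof -
  define f :: "'a \<Rightarrow> 'a \<Rightarrow> int" where "f = (\<lambda>p w. \<lfloor>w \<bullet> p\<rfloor>)"
  have f: "real_of_int (f p w) = w \<bullet> p" if "p \<in> P" "w \<in> W" for p w
    using int[OF that] by (simp add: f_def)
  have fK: "\<forall>p\<in>P. \<forall>w\<in>W. \<bar>f p w\<bar> \<le> int K"
  proof (intro ballI)
    fix p w assume "p \<in> P" "w \<in> W"
    then show "\<bar>f p w\<bar> \<le> int K" using K[of p w] f[of p w] by linarith
  qed
  obtain z p where z: "\<forall>w\<in>W. 0 \<le> z w \<and> z w \<le> int (2 * card W * K)" and p: "p \<in> P"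
    and min: "\<forall>q\<in>P. (\<Sum>w\<in>W. z w * f p w) < (\<Sum>w\<in>W. z w * f q w) \<or> (\<forall>w\<in>W. f q w = f p w)"
    using isolation[OF W P(1,2) fK] by (elim exE conjE) (rule that)
  have val: "(\<Sum>w\<in>W. of_int (z w) *\<^sub>R w) \<bullet> q = of_int (\<Sum>w\<in>W. z w * f q w)" if "q \<in> P" for q
    using f[OF that] by (simp add: inner_sum_left)
  have "(\<Sum>w\<in>W. of_int (z w) *\<^sub>R w) \<bullet> p < (\<Sum>w\<in>W. of_int (z w) *\<^sub>R w) \<bullet> q"
    if q: "q \<in> P" "q \<noteq> p" for q
  proof -
    have "\<not> (\<forall>w\<in>W. f q w = f p w)"
    proof
      assume eq: "\<forall>w\<in>W. f q w = f p w"
      have "orthogonal (q - p) w" if "w \<in> W" for w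
      proof -
        have "w \<bullet> q = w \<bullet> p"
          using f[OF q(1) that] f[OF p that] eq that by simp
        then show ?thesis
          by (simp add: orthogonal_def inner_commute[of _ w] inner_diff_right)
      qed
      moreover have "q - p \<in> span W" using P(3) p q by (auto intro: span_diff)
      ultimately have "orthogonal (q - p) (q - p)"
        by (metis orthogonal_to_span)
      then show False using q by (simp add: orthogonal_self)
    qed
    then have "(\<Sum>w\<in>W. z w * f p w) < (\<Sum>w\<in>W. z w * f q w)"
      using bspec[OF min q(1)] by blast
    then show ?thesis by (simp only: val[OF p] val[OF q(1)] of_int_less_iff)
  qed
  with z p show ?thesis by blast
qed

section \<open>Chains from weighted ordered bases\<close>

text \<open>Spanning is the only condition stored: when \<open>dim A = n\<close>, n spanning vectors
  are automatically distinct and independent. \<open>PiE\<close> fixes the values outside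
  \<open>{1..n}\<close>, so a finite \<open>A\<close> has finitely many ordered bases.\<close>

definition ordered_bases :: "nat \<Rightarrow> 'a::euclidean_space set \<Rightarrow> (nat \<Rightarrow> 'a) set" where
  "ordered_bases n A = {y \<in> PiE {1..n} (\<lambda>_. A). A \<subseteq> span (y ` {1..n})}"

definition weighted_sum :: "nat \<Rightarrow> (nat \<Rightarrow> 'a::euclidean_space) \<Rightarrow> 'a" where
  "weighted_sum n y = (\<Sum>j=1..n. real (n + 1 - j) *\<^sub>R y j)"

lemma ordered_basis_independent:
  assumes y: "y \<in> ordered_bases n A" and n: "dim A = n" and j: "j \<in> {1..n}"
  shows "y j \<notin> span (y ` {1..<j})"
proof -
  let ?Y = "y ` {1..n}"
  have sub: "?Y \<subseteq> A" and sp: "A \<subseteq> span ?Y" using y by (auto simp: ordered_bases_def)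
  have "card ?Y \<le> n" using card_image_le[of "{1..n}" y] by simp
  then have ind: "independent ?Y"
    using card_le_dim_spanning[OF sub sp] n by simp
  have "n \<le> card ?Y" using dim_le_card[OF sp] n by simp
  with \<open>card ?Y \<le> n\<close> have inj: "inj_on y {1..n}"
    by (intro eq_card_imp_inj_on) auto
  have "y ` {1..<j} \<subseteq> ?Y - {y j}"
    using inj j by (auto dest: inj_onD)
  moreover have "y j \<notin> span (?Y - {y j})"
    using ind j by (auto simp: dependent_def)
  ultimately show ?thesis using span_mono by blast
qed

text \<open>Suppose \<open>a\<close> is a competitor that is no worse than \<open>y j\<close>.
  Replacing a later vector \<open>y k\<close> by \<open>a\<close> shows, since the weights are
  positive, that \<open>y k\<close> is no worse than \<open>a\<close>, hence no worse than
  \<open>y j\<close>. Since the weights decrease strictly, swapping positions \<open>j\<close> and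
  \<open>k\<close> then puts the smaller value under the larger weight, against minimality.\<close>

lemma unique_weighted_sum_chain:
  fixes A :: "'a::euclidean_space set"
  assumes n: "dim A = n"
    and y: "y \<in> ordered_bases n A"
    and min: "\<And>y'. y' \<in> ordered_bases n A \<Longrightarrow> weighted_sum n y' \<noteq> weighted_sum n y \<Longrightarrow>
                v \<bullet> weighted_sum n y < v \<bullet> weighted_sum n y'"
  shows "uniquely_defines_chain v n A"
  unfolding uniquely_defines_chain_def
proof (intro exI ballI conjI impI)
  fix j assume j: "j \<in> {1..n}"
  then show "y j \<in> A - span (y ` {1..<j})"
    using ordered_basis_independent[OF y n j] y by (auto simp: ordered_bases_def)
  fix a assume a: "a \<in> A - span (y ` {1..<j})" and ne: "a \<noteq> y j"
  show "v \<bullet> y j < v \<bullet> a"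
  proof (rule ccontr)
    assume "\<not> v \<bullet> y j < v \<bullet> a"
    then have le: "v \<bullet> a \<le> v \<bullet> y j" by simp
    have sp: "A \<subseteq> span (y ` {1..n})" using y by (simp add: ordered_bases_def)
    \<comment> \<open>At the first prefix whose span contains \<open>a\<close>, the vector
      \<open>a\<close> genuinely involves \<open>y k\<close>, so the two can be exchanged. As
      \<open>a\<close> avoids the span of the first \<open>j - 1\<close> vectors, \<open>k\<close>
      is at least \<open>j\<close>.\<close>
    define k where "k = (LEAST k. a \<in> span (y ` {1..k}))"
    have ex: "a \<in> span (y ` {1..n})" using a sp by blast
    have ak: "a \<in> span (y ` {1..k})" unfolding k_def using ex by (rule LeastI)
    have kn: "k \<le> n" unfolding k_def using ex by (rule Least_le)
    have jk: "j \<le> k"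
    proof (rule ccontr)
      assume "\<not> j \<le> k"
      then have "y ` {1..k} \<subseteq> y ` {1..<j}" by auto
      then show False using ak a span_mono by blast
    qed
    then have k1: "1 \<le> k" using j by simp
    have nk: "a \<notin> span (y ` {1..<k})"
    proof -
      have "{1..<k} = {1..k - 1}" using k1 by auto
      moreover have "a \<notin> span (y ` {1..k - 1})"
        using not_less_Least[of "k - 1" "\<lambda>k. a \<in> span (y ` {1..k})"] k1 by (simp add: k_def)
      ultimately show ?thesis by simp
    qed
    have splitk: "{1..n} = insert k ({1..n} - {k})" using k1 kn by auto
    define y1 where "y1 = y(k := a)"
    have y1: "y1 \<in> ordered_bases n A"
    proof -
      have im: "insert a (y ` {1..<k}) \<subseteq> y1 ` {1..n}"
      proof -
        have "a = y1 k" "\<And>i. i \<in> {1..<k} \<Longrightarrow> y i = y1 i" by (auto simp: y1_def)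
        then show ?thesis using k1 kn by auto
      qed
      have "{1..k} = insert k {1..<k}" using k1 by auto
      then have "a \<in> span (insert (y k) (y ` {1..<k}))" using ak by simp
      then have "y k \<in> span (insert a (y ` {1..<k}))" using nk by (rule in_span_insert)
      then have yk: "y k \<in> span (y1 ` {1..n})" using span_mono[OF im] by blast
      have "y i \<in> span (y1 ` {1..n})" if "i \<in> {1..n}" for i
      proof (cases "i = k")
        case False
        then have "y i = y1 i" by (simp add: y1_def)
        then show ?thesis using that by (simp add: span_base)
      qed (use yk in simp)
      then have "span (y ` {1..n}) \<subseteq> span (y1 ` {1..n})"
        by (intro span_minimal) auto
      moreover have "y1 \<in> PiE {1..n} (\<lambda>_. A)"
        using y a k1 kn by (auto simp: y1_def ordered_bases_def PiE_iff extensional_def)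
      ultimately show ?thesis using sp by (auto simp: ordered_bases_def)
    qed
    have d1: "weighted_sum n y1 = weighted_sum n y + real (n + 1 - k) *\<^sub>R (a - y k)"
    proof -
      have "(\<Sum>i\<in>{1..n}-{k}. real (n + 1 - i) *\<^sub>R y1 i) = (\<Sum>i\<in>{1..n}-{k}. real (n + 1 - i) *\<^sub>R y i)"
        by (intro sum.cong) (auto simp: y1_def)
      moreover have "(\<Sum>i=1..n. g i) = g k + (\<Sum>i\<in>{1..n}-{k}. g i)" for g :: "nat \<Rightarrow> 'a"
        using k1 kn by (intro sum.remove) auto
      ultimately show ?thesis unfolding weighted_sum_def
        using kn by (simp add: y1_def algebra_simps of_nat_diff)
    qed
    have pos: "real (n + 1 - k) > 0" using kn by simp
    show False
    proof (cases "k = j")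
      case True
      then have "v \<bullet> weighted_sum n y < v \<bullet> weighted_sum n y1"
        using ne pos by (intro min[OF y1]) (simp add: d1)
      then show False using pos le True
        by (simp add: d1 inner_add_right inner_diff_right zero_less_mult_iff)
    next
      case False
      \<comment> \<open>Here \<open>a\<close> may be \<open>y k\<close> itself, and then the
        replacement changes nothing. The weak inequality suffices, since the swap below supplies
        strictness.\<close>
      have "v \<bullet> weighted_sum n y \<le> v \<bullet> weighted_sum n y1"
        using min[OF y1] by (cases "weighted_sum n y1 = weighted_sum n y") auto
      then have vk: "v \<bullet> y k \<le> v \<bullet> y j"
        using pos le by (simp add: d1 inner_add_right inner_diff_right zero_le_mult_iff)
      define y2 where "y2 = y(j := y k, k := y j)"
      have jn: "j \<in> {1..n}" "k \<in> {1..n}" using j k1 kn by auto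
      have im: "y2 ` {1..n} = y ` {1..n}"
      proof -
        have "y2 j = y k" "y2 k = y j" "\<And>i. i \<noteq> j \<Longrightarrow> i \<noteq> k \<Longrightarrow> y2 i = y i"
          using False by (auto simp: y2_def)
        then have "y i \<in> y2 ` {1..n} \<and> y2 i \<in> y ` {1..n}" if "i \<in> {1..n}" for i
          using jn that
          by (cases "i = j"; cases "i = k") (auto intro: image_eqI[of _ _ k] image_eqI[of _ _ j] image_eqI[of _ _ i])
        then show ?thesis by blast
      qed
      have y2: "y2 \<in> ordered_bases n A"
        using y jn unfolding ordered_bases_def mem_Collect_eq im
        by (auto simp: y2_def PiE_iff extensional_def)
      have d2: "weighted_sum n y2 = weighted_sum n y + (real k - real j) *\<^sub>R (y k - y j)"
      proof -
        have S: "(\<Sum>i=1..n. g i) = g j + (g k + (\<Sum>i\<in>{1..n}-{j}-{k}. g i))" for g :: "nat \<Rightarrow> 'a"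
        proof -
          have "sum g {1..n} = g j + sum g ({1..n} - {j})"
            using jn by (intro sum.remove) auto
          also have "sum g ({1..n} - {j}) = g k + sum g ({1..n} - {j} - {k})"
            using jn False by (intro sum.remove) auto
          finally show ?thesis .
        qed
        have "(\<Sum>i\<in>{1..n}-{j}-{k}. real (n + 1 - i) *\<^sub>R y2 i)
            = (\<Sum>i\<in>{1..n}-{j}-{k}. real (n + 1 - i) *\<^sub>R y i)"
          by (intro sum.cong) (auto simp: y2_def)
        then show ?thesis unfolding weighted_sum_def S
          using jn False by (simp add: y2_def algebra_simps of_nat_diff)
      qed
      have "y j \<in> span (y ` {1..<k})" using False jk j by (intro span_base) auto
      moreover have "y k \<notin> span (y ` {1..<k})" using ordered_basis_independent[OF y n jn(2)] .
      ultimately have "y k \<noteq> y j" by auto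
      then have "v \<bullet> weighted_sum n y < v \<bullet> weighted_sum n y2"
        using False by (intro min[OF y2]) (simp add: d2)
      then show False using vk jk False
        by (simp add: d2 inner_add_right inner_diff_right zero_less_mult_iff)
    qed
  qed
qed

lemma ordered_bases_nonempty:
  fixes A :: "'a::euclidean_space set"
  assumes "dim A = n" shows "ordered_bases n A \<noteq> {}"
proof -
  obtain B where B: "B \<subseteq> A" "independent B" "A \<subseteq> span B" "card B = n"
    using basis_exists[of A] assms by metis
  obtain y where y: "bij_betw y {1..n} B"
    using ex_bij_betw_nat_finite_1[of B] B finiteI_independent by blast
  have "restrict y {1..n} ` {1..n} = B" using y by (simp add: bij_betw_def)
  then have "restrict y {1..n} \<in> ordered_bases n A"
    using B unfolding ordered_bases_def by auto
  then show ?thesis by blast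
qed

lemma inner_weighted_sum_le:
  assumes "\<And>j. j \<in> {1..n} \<Longrightarrow> \<bar>w \<bullet> y j\<bar> \<le> c"
  shows "\<bar>w \<bullet> weighted_sum n y\<bar> \<le> (real n)\<^sup>2 * c"
proof -
  have "\<bar>w \<bullet> weighted_sum n y\<bar> \<le> (\<Sum>j=1..n. \<bar>real (n + 1 - j) * (w \<bullet> y j)\<bar>)"
    unfolding weighted_sum_def inner_sum_right inner_scaleR_right by (rule sum_abs)
  also have "\<dots> \<le> (\<Sum>j=1..n. real n * c)"
    using assms by (intro sum_mono) (auto simp: abs_mult intro!: mult_mono)
  also have "\<dots> = (real n)\<^sup>2 * c" by (simp add: power2_eq_square)
  finally show ?thesis .
qed

section \<open>Discrete subgroups\<close>

definition int_span :: "'a::euclidean_space set \<Rightarrow> 'a set" where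
  "int_span B = {(\<Sum>b\<in>B. of_int (z b) *\<^sub>R b) | z :: 'a \<Rightarrow> int. True}"

text \<open>Finiteness in every ball gives shortest vectors directly and is inherited by
  projections. Being free of bases, the notion covers the lattice, its dual and all projected
  subgroups alike.\<close>

definition discrete_subgroup :: "'a::euclidean_space set \<Rightarrow> bool" where
  "discrete_subgroup D \<longleftrightarrow>
     0 \<in> D \<and> (\<forall>x\<in>D. \<forall>y\<in>D. x - y \<in> D) \<and> (\<forall>r. finite (D \<inter> cball 0 r))"

text \<open>The orthogonal projection onto the complement of \<open>w\<close>; it is the identity
  for \<open>w = 0\<close>.\<close>

definition reject :: "'a::euclidean_space \<Rightarrow> 'a \<Rightarrow> 'a" where
  "reject w x = x - ((x \<bullet> w) / (w \<bullet> w)) *\<^sub>R w"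

lemma reject_orthogonal: "reject w x \<bullet> w = 0"
  by (cases "w = 0") (simp_all add: reject_def inner_diff_left)

lemma reject_diff: "reject w (x - y) = reject w x - reject w y"
  by (simp add: reject_def inner_diff_left diff_divide_distrib algebra_simps)

lemma linear_reject: "linear (reject w)"
  by (rule linearI)
    (simp_all add: reject_def inner_add_left add_divide_distrib algebra_simps)

lemma discrete_subgroup_add:
  assumes "discrete_subgroup D" "x \<in> D" "y \<in> D" shows "x + y \<in> D"
proof -
  have "0 - y \<in> D" using assms unfolding discrete_subgroup_def by blast
  then have "x - (0 - y) \<in> D" using assms unfolding discrete_subgroup_def by blast
  then show ?thesis by simp
qed

lemma discrete_subgroup_scale:
  assumes D: "discrete_subgroup D" and x: "x \<in> D" shows "of_int k *\<^sub>R x \<in> D"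
proof (induction k rule: int_induct[where k = 0])
  case base then show ?case using D by (simp add: discrete_subgroup_def)
next
  case (step1 i) then show ?case
    using discrete_subgroup_add[OF D _ x] by (simp add: scaleR_left_distrib)
next
  case (step2 i) then show ?case
    using D x by (simp add: discrete_subgroup_def scaleR_left_diff_distrib)
qed

lemma discrete_subgroup_int_combination:
  assumes D: "discrete_subgroup D" and x: "\<And>i. i \<in> I \<Longrightarrow> x i \<in> D"
  shows "(\<Sum>i\<in>I. of_int (z i) *\<^sub>R x i) \<in> D"
  using x
proof (induction I rule: infinite_finite_induct)
  case (insert i I)
  then show ?case
    using discrete_subgroup_add[OF D] discrete_subgroup_scale[OF D] by simp
qed (use D in \<open>simp_all add: discrete_subgroup_def\<close>)

lemma int_spanI: "(\<Sum>b\<in>B. of_int (z b) *\<^sub>R b) \<in> int_span B"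
  unfolding int_span_def by blast

lemma int_span_base:
  assumes "finite B" "b \<in> B" shows "b \<in> int_span B"
proof -
  have "(\<Sum>c\<in>B. of_int (if c = b then 1 else 0) *\<^sub>R c) = (\<Sum>c\<in>B. if c = b then c else 0)"
    by (intro sum.cong) auto
  also have "\<dots> = b" using assms by simp
  finally show ?thesis using int_spanI[of "\<lambda>c. if c = b then 1 else 0" B] by simp
qed

lemma span_int_span:
  assumes "finite B" shows "span (int_span B) = span B"
proof
  show "span (int_span B) \<subseteq> span B"
    by (intro span_minimal) (auto simp: int_span_def intro!: span_sum intro: span_scale span_base)
  have "b \<in> int_span B" if "b \<in> B" for b
    using int_span_base[OF assms that] .
  then show "span B \<subseteq> span (int_span B)" by (intro span_mono) auto
qed

text \<open>In a ball the inner products with the finite set \<open>G\<close> are bounded integers,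
  so only finitely many tuples of them occur, and a vector of \<open>span G\<close> is determined by
  its tuple.\<close>

lemma discrete_subgroupI:
  assumes G: "finite G" and sub: "D \<subseteq> span G" and int: "\<And>d g. d \<in> D \<Longrightarrow> g \<in> G \<Longrightarrow> d \<bullet> g \<in> \<int>"
    and zero: "0 \<in> D" and diff: "\<And>x y. x \<in> D \<Longrightarrow> y \<in> D \<Longrightarrow> x - y \<in> D"
  shows "discrete_subgroup D"
proof -
  have "finite (D \<inter> cball 0 r)" for r
  proof (rule finite_imageD)
    let ?\<phi> = "\<lambda>d. \<lambda>g\<in>G. d \<bullet> g"
    let ?I = "\<lambda>g. real_of_int ` {\<lfloor>- (r * norm g)\<rfloor>..\<lfloor>r * norm g\<rfloor>}"
    have "?\<phi> ` (D \<inter> cball 0 r) \<subseteq> PiE G ?I"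
    proof (clarsimp simp: PiE_iff)
      fix d g assume d: "d \<in> D" "norm d \<le> r" and g: "g \<in> G"
      obtain k where k: "d \<bullet> g = of_int k" using int[OF d(1) g] by (auto elim: Ints_cases)
      have "\<bar>d \<bullet> g\<bar> \<le> r * norm g"
        using Cauchy_Schwarz_ineq2[of d g] mult_right_mono[OF d(2), of "norm g"] by simp
      then have "\<lfloor>- (r * norm g)\<rfloor> \<le> k" "k \<le> \<lfloor>r * norm g\<rfloor>"
        unfolding k by linarith+
      then show "d \<bullet> g \<in> ?I g" unfolding k by simp
    qed
    moreover have "finite (PiE G ?I)" using G by (intro finite_PiE) auto
    ultimately show "finite (?\<phi> ` (D \<inter> cball 0 r))" by (rule finite_subset)
    show "inj_on ?\<phi> (D \<inter> cball 0 r)"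
    proof (rule inj_onI)
      fix x y assume xy: "x \<in> D \<inter> cball 0 r" "y \<in> D \<inter> cball 0 r" and eq: "?\<phi> x = ?\<phi> y"
      have "orthogonal (x - y) g" if "g \<in> G" for g
        using fun_cong[OF eq, of g] that by (simp add: orthogonal_def inner_diff_left)
      moreover have "x - y \<in> span G" using xy sub by (auto intro: span_diff)
      ultimately have "orthogonal (x - y) (x - y)" by (metis orthogonal_to_span)
      then show "x = y" by (simp add: orthogonal_self)
    qed
  qed
  then show ?thesis using zero diff by (simp add: discrete_subgroup_def)
qed

lemma discrete_subgroup_shortest:
  assumes D: "discrete_subgroup D" and x: "x \<in> D" "x \<noteq> 0"
  shows "\<exists>w\<in>D. w \<noteq> 0 \<and> (\<forall>y\<in>D. y \<noteq> 0 \<longrightarrow> norm w \<le> norm y)"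
proof -
  let ?S = "D \<inter> cball 0 (norm x) - {0}"
  have fin: "finite ?S" using D by (simp add: discrete_subgroup_def)
  have ne: "?S \<noteq> {}" using x by auto
  let ?w = "arg_min_on norm ?S"
  have w: "?w \<in> ?S" using arg_min_if_finite(1)[OF fin ne] .
  have "norm ?w \<le> norm y" if "y \<in> D" "y \<noteq> 0" for y
  proof (cases "norm y \<le> norm x")
    case True
    then show ?thesis using arg_min_least[OF fin ne, of y norm] that by auto
  next
    case False
    then show ?thesis using w by auto
  qed
  with w show ?thesis by blast
qed

text \<open>Subtracting integer multiples of \<open>w\<close> does not change the projection, so the
  coefficient along \<open>w\<close> can be rounded away up to 1/2. This controls both the
  discreteness of the projection and the length of lifted vectors.\<close>

lemma reject_lift:
  assumes D: "discrete_subgroup D" and w: "w \<in> D" and x: "x \<in> D"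
  obtains y where "y \<in> D" "reject w y = reject w x" "norm (y - reject w x) \<le> norm w / 2"
proof (cases "w = 0")
  case True
  then show ?thesis using that[OF x] by (simp add: reject_def)
next
  case False
  define t where "t = (x \<bullet> w) / (w \<bullet> w)"
  define y where "y = x - of_int (round t) *\<^sub>R w"
  have "y \<in> D"
    using D x discrete_subgroup_scale[OF D w] unfolding y_def discrete_subgroup_def by blast
  moreover have "reject w y = reject w x"
    using False by (simp add: reject_def y_def inner_diff_left diff_divide_distrib algebra_simps)
  moreover have "y - reject w x = (t - of_int (round t)) *\<^sub>R w"
    by (simp add: y_def reject_def t_def algebra_simps)
  then have "norm (y - reject w x) = \<bar>t - of_int (round t)\<bar> * norm w" by simp
  moreover have "\<bar>t - of_int (round t)\<bar> * norm w \<le> 1/2 * norm w"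
    using of_int_round_abs_le[of t] by (intro mult_right_mono) (auto simp: abs_minus_commute)
  ultimately show ?thesis using that by simp
qed

text \<open>A projected vector in the ball of radius r has a lift in the ball of radius r +
  \<open>norm w / 2\<close>, and that ball contains finitely many elements of
  \<open>D\<close>.\<close>

lemma discrete_subgroup_reject:
  assumes D: "discrete_subgroup D" and w: "w \<in> D"
  shows "discrete_subgroup (reject w ` D)"
proof -
  have "finite (reject w ` D \<inter> cball 0 r)" for r
  proof (rule finite_subset)
    show "reject w ` D \<inter> cball 0 r \<subseteq> reject w ` (D \<inter> cball 0 (r + norm w / 2))"
    proof clarsimp
      fix x assume x: "x \<in> D" "norm (reject w x) \<le> r"
      obtain y where y: "y \<in> D" "reject w y = reject w x" "norm (y - reject w x) \<le> norm w / 2"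
        using reject_lift[OF D w x(1)] .
      have "norm y \<le> r + norm w / 2"
        using y(3) x(2) norm_triangle_sub[of y "reject w x"] by simp
      then show "reject w x \<in> reject w ` (D \<inter> cball 0 (r + norm w / 2))"
        using y by (intro image_eqI[of _ _ y]) auto
    qed
    show "finite (reject w ` (D \<inter> cball 0 (r + norm w / 2)))"
      using D by (simp add: discrete_subgroup_def)
  qed
  moreover have "0 = reject w 0" by (simp add: reject_def)
  then have "0 \<in> reject w ` D" using D unfolding discrete_subgroup_def by blast
  moreover have "reject w x - reject w y \<in> reject w ` D" if "x \<in> D" "y \<in> D" for x y
    using D that unfolding discrete_subgroup_def reject_diff[symmetric] by blast
  ultimately show ?thesis by (auto simp: discrete_subgroup_def)
qed

lemma span_insert_reject:
  assumes "w \<in> D" shows "span (insert w (reject w ` D)) = span D"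
proof
  have "reject w x \<in> span D" if "x \<in> D" for x
    unfolding reject_def using assms that by (intro span_diff span_scale span_base)
  then show "span (insert w (reject w ` D)) \<subseteq> span D"
    using assms by (intro span_minimal) (auto intro: span_base)
  have "x \<in> span (insert w (reject w ` D))" if "x \<in> D" for x
  proof -
    have "x = reject w x + ((x \<bullet> w) / (w \<bullet> w)) *\<^sub>R w" by (simp add: reject_def)
    also have "\<dots> \<in> span (insert w (reject w ` D))"
      using that by (intro span_add span_scale span_base) auto
    finally show ?thesis .
  qed
  then show "span D \<subseteq> span (insert w (reject w ` D))" by (intro span_minimal) auto
qed

lemma dim_reject:
  assumes w: "w \<in> D" "w \<noteq> 0" shows "dim D = Suc (dim (reject w ` D))"
proof -
  have "w \<notin> span (reject w ` D)"
  proof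
    assume "w \<in> span (reject w ` D)"
    moreover have "orthogonal w y" if "y \<in> reject w ` D" for y
      using that reject_orthogonal by (auto simp: orthogonal_def inner_commute)
    ultimately have "orthogonal w w" by (metis orthogonal_to_span)
    then show False using w by (simp add: orthogonal_self)
  qed
  then show ?thesis
    using span_insert_reject[OF w(1)] dim_span[of D] dim_span[of "insert w (reject w ` D)"]
    by (simp add: dim_insert)
qed

text \<open>Projecting the new set along \<open>w\<close> gives back \<open>W\<close>, apart from 0,
  so \<open>span_insert_reject\<close> applied to the new set itself identifies its span.
  Independence and the exact cardinality follow by counting against the dimension. The lifts are
  arbitrary, which serves lattice bases and short vectors equally.\<close>

lemma independent_insert_lift:
  assumes w: "w \<in> D" "w \<noteq> 0"
    and W: "finite W" "independent W" "span W = span (reject w ` D)"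
    and l: "\<And>u. u \<in> W \<Longrightarrow> l u \<in> D \<and> reject w (l u) = u"
  shows "independent (insert w (l ` W))" "card (insert w (l ` W)) = Suc (card W)"
    "span (insert w (l ` W)) = span D"
proof -
  let ?V = "insert w (l ` W)"
  have "reject w ` ?V = insert 0 W"
  proof -
    have "reject w w = 0" using w by (simp add: reject_def)
    moreover have "reject w ` l ` W = W" using l by (force simp: image_iff)
    ultimately show ?thesis by simp
  qed
  then have "span (insert w (insert 0 W)) = span ?V"
    using span_insert_reject[of w ?V] by simp
  moreover have "span (insert w (insert 0 W)) = span (insert w W)"
    by (metis insert_commute span_insert_0)
  moreover have "span (insert w W) = span (insert w (reject w ` D))"
    using W(3) by (simp add: span_insert)
  ultimately show span: "span ?V = span D"
    using span_insert_reject[OF w(1)] by simp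
  have "dim ?V = dim D" by (metis span dim_span)
  also have "\<dots> = Suc (card W)"
    using dim_reject[OF w] W by (metis dim_span dim_span_eq_card_independent)
  finally have d: "dim ?V = Suc (card W)" .
  have "card ?V \<le> Suc (card W)"
    using card_insert_le_m1 card_image_le[OF W(1), of l] W(1)
    by (metis card_insert_if finite_imageI le_SucI not_less_eq_eq)
  then show "independent ?V"
    using card_le_dim_spanning[of ?V ?V] W(1) d by (simp add: span_superset)
  then show "card ?V = Suc (card W)"
    using d by (metis dim_span_eq_card_independent dim_span)
qed

text \<open>Induction on the dimension: a basis of the projection along a shortest vector
  \<open>w\<close> is lifted and joined by \<open>w\<close>. Taking \<open>w\<close> shortest
  ensures that the elements of \<open>D\<close> on its line are exactly its integer
  multiples.\<close>

lemma discrete_subgroup_basis: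
  fixes D :: "'a::euclidean_space set"
  assumes "discrete_subgroup D"
  shows "\<exists>B. finite B \<and> independent B \<and> D = int_span B"
  using assms
proof (induction "dim D" arbitrary: D)
  case 0
  then have "D = {0}" by (auto simp: discrete_subgroup_def)
  then have "D = int_span {}" by (simp add: int_span_def)
  then show ?case by (intro exI[of _ "{}"]) (simp add: independent_empty)
next
  case (Suc n)
  then have "\<not> D \<subseteq> {0}" by (metis dim_eq_0 nat.distinct(1))
  then obtain x where x: "x \<in> D" "x \<noteq> 0" by blast
  then obtain w where w: "w \<in> D" "w \<noteq> 0" and short: "\<And>y. y \<in> D \<Longrightarrow> y \<noteq> 0 \<Longrightarrow> norm w \<le> norm y"
    using discrete_subgroup_shortest[OF Suc.prems x] by blast
  have D': "discrete_subgroup (reject w ` D)"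
    using discrete_subgroup_reject[OF Suc.prems w(1)] .
  have "n = dim (reject w ` D)" using dim_reject[OF w] Suc.hyps(2) by simp
  from Suc.hyps(1)[OF this D'] obtain B where B: "finite B" "independent B" "reject w ` D = int_span B"
    by blast
  have "\<exists>y\<in>D. reject w y = b" if "b \<in> B" for b
    using int_span_base[OF B(1) that] unfolding B(3)[symmetric] by blast
  then obtain l where l: "\<And>b. b \<in> B \<Longrightarrow> l b \<in> D \<and> reject w (l b) = b" by metis
  let ?V = "insert w (l ` B)"
  have span: "span B = span (reject w ` D)" using span_int_span[OF B(1)] B(3) by simp
  note V = independent_insert_lift[OF w B(1,2) span l]
  have "int_span ?V \<subseteq> D"
    unfolding int_span_def using l w
    by (auto intro!: discrete_subgroup_int_combination[OF Suc.prems] simp del: sum.insert)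
  moreover have "D \<subseteq> int_span ?V"
  proof
    fix x assume x: "x \<in> D"
    have inj: "inj_on l B" by (rule inj_onI) (metis l)
    have wl: "w \<notin> l ` B"
      using V(2) card_image[OF inj] B(1) by (metis card_insert_if finite_imageI n_not_Suc_n)
    have "reject w x \<in> int_span B" using x B(3) by blast
    then obtain z :: "'a \<Rightarrow> int" where z: "reject w x = (\<Sum>b\<in>B. of_int (z b) *\<^sub>R b)"
      by (auto simp: int_span_def)
    define y where "y = x - (\<Sum>b\<in>B. of_int (z b) *\<^sub>R l b)"
    have "(\<Sum>b\<in>B. of_int (z b) *\<^sub>R l b) \<in> D"
      by (rule discrete_subgroup_int_combination[OF Suc.prems]) (simp add: l)
    then have y: "y \<in> D" using x Suc.prems unfolding y_def discrete_subgroup_def by blast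
    have y0: "reject w y = 0"
      unfolding y_def reject_diff z linear_sum[OF linear_reject]
      by (simp add: linear_scale[OF linear_reject] l)
    \<comment> \<open>\<open>y\<close> lies on the line through \<open>w\<close>. What remains after
      removing the integer part of its coefficient is an element of \<open>D\<close> shorter than
      \<open>w\<close>, hence 0.\<close>
    have "y - of_int \<lfloor>(y \<bullet> w) / (w \<bullet> w)\<rfloor> *\<^sub>R w = 0"
    proof (rule ccontr)
      define t where "t = (y \<bullet> w) / (w \<bullet> w)"
      assume "y - of_int \<lfloor>(y \<bullet> w) / (w \<bullet> w)\<rfloor> *\<^sub>R w \<noteq> 0"
      moreover have "y - of_int \<lfloor>t\<rfloor> *\<^sub>R w \<in> D"
        using y discrete_subgroup_scale[OF Suc.prems w(1)] Suc.prems
        unfolding discrete_subgroup_def by blast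
      ultimately have "norm w \<le> norm (y - of_int \<lfloor>t\<rfloor> *\<^sub>R w)"
        using short unfolding t_def by blast
      also have "y - of_int \<lfloor>t\<rfloor> *\<^sub>R w = (t - of_int \<lfloor>t\<rfloor>) *\<^sub>R w"
        using y0 by (simp add: reject_def t_def algebra_simps)
      also have "norm \<dots> = (t - of_int \<lfloor>t\<rfloor>) * norm w" by simp
      also have "\<dots> < 1 * norm w"
        using w(2) by (intro mult_strict_right_mono) (auto, linarith)
      finally show False by simp
    qed
    then have "y = of_int \<lfloor>(y \<bullet> w) / (w \<bullet> w)\<rfloor> *\<^sub>R w" by simp
    then obtain k :: int where k: "y = of_int k *\<^sub>R w" by blast
    \<comment> \<open>\<open>reject w\<close> inverts \<open>l\<close> on the lifted vectors, so it
      transports the coefficients from \<open>B\<close>.\<close>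
    define u where "u = (\<lambda>v. if v = w then k else z (reject w v))"
    have "(\<Sum>v\<in>?V. of_int (u v) *\<^sub>R v) = of_int (u w) *\<^sub>R w + (\<Sum>v\<in>l ` B. of_int (u v) *\<^sub>R v)"
      using wl B(1) by simp
    also have "(\<Sum>v\<in>l ` B. of_int (u v) *\<^sub>R v) = (\<Sum>b\<in>B. of_int (u (l b)) *\<^sub>R l b)"
      using inj by (simp add: sum.reindex)
    also have "\<dots> = (\<Sum>b\<in>B. of_int (z b) *\<^sub>R l b)"
      using l wl by (intro sum.cong) (auto simp: u_def)
    also have "of_int (u w) *\<^sub>R w + \<dots> = x" using k by (simp add: u_def y_def algebra_simps)
    finally show "x \<in> int_span ?V" by (metis int_spanI)
  qed
  ultimately show ?case using V(1) B(1) by (intro exI[of _ ?V]) auto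
qed

section \<open>Dual bases and dual lattices\<close>

lemma dual_basis_exists:
  fixes B :: "'a::euclidean_space set"
  assumes ind: "independent B"
  obtains \<beta> where "\<And>b. b \<in> B \<Longrightarrow> \<beta> b \<in> span B"
    "\<And>b c. b \<in> B \<Longrightarrow> c \<in> B \<Longrightarrow> \<beta> b \<bullet> c = (if b = c then 1 else 0)"
proof -
  have "\<exists>u\<in>span B. \<forall>c\<in>B. u \<bullet> c = (if b = c then 1 else 0)" if b: "b \<in> B" for b
  proof -
    \<comment> \<open>The dual vector of \<open>b\<close> is the component \<open>u\<close> of
      \<open>b\<close> orthogonal to the other basis vectors, rescaled to have inner product 1 with
      \<open>b\<close>.\<close>
    obtain y u where y: "y \<in> span (B - {b})" and u: "\<And>v. v \<in> span (B - {b}) \<Longrightarrow> orthogonal u v"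
      and b_eq: "b = y + u"
      by (rule orthogonal_subspace_decomp_exists[of "B - {b}" b]) blast
    have "u \<noteq> 0" using ind b y b_eq by (auto simp: dependent_def)
    have ub: "u \<bullet> b = u \<bullet> u" using u[OF y] b_eq by (simp add: orthogonal_def inner_add_right)
    have "y \<in> span B" using y span_mono[of "B - {b}" B] by blast
    then have "b - y \<in> span B" using span_base[OF b] by (intro span_diff)
    then have "u \<in> span B" using b_eq by simp
    then have "(1 / (u \<bullet> u)) *\<^sub>R u \<in> span B" by (rule span_scale)
    moreover have "((1 / (u \<bullet> u)) *\<^sub>R u) \<bullet> c = (if b = c then 1 else 0)" if "c \<in> B" for c
      using u[OF span_base, of c] that ub \<open>u \<noteq> 0\<close> by (auto simp: orthogonal_def)
    ultimately show ?thesis by blast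
  qed
  then show ?thesis using that by metis
qed

lemma dual_basis_expand:
  fixes B :: "'a::euclidean_space set"
  assumes B: "finite B" and \<beta>: "\<And>b c. b \<in> B \<Longrightarrow> c \<in> B \<Longrightarrow> \<beta> b \<bullet> c = (if b = c then 1 else 0)"
    and x: "x \<in> span B"
  shows "x = (\<Sum>b\<in>B. (x \<bullet> \<beta> b) *\<^sub>R b)"
proof -
  obtain u where u: "x = (\<Sum>b\<in>B. u b *\<^sub>R b)" using x span_finite[OF B] by auto
  have "x \<bullet> \<beta> c = u c" if "c \<in> B" for c
  proof -
    have "x \<bullet> \<beta> c = (\<Sum>b\<in>B. u b * (\<beta> c \<bullet> b))"
      by (subst inner_commute) (simp add: u inner_sum_right)
    also have "\<dots> = (\<Sum>b\<in>B. if c = b then u b else 0)"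
      using \<beta> that by (intro sum.cong) auto
    also have "\<dots> = u c" using B that by simp
    finally show ?thesis .
  qed
  then show ?thesis using u by simp
qed

text \<open>A vector of \<open>span B\<close> orthogonal to every \<open>\<beta> b\<close> has all
  its coordinates in \<open>B\<close> equal to 0, so the dual vectors leave no orthogonal
  remainder.\<close>

lemma dual_basis_span:
  fixes B :: "'a::euclidean_space set"
  assumes B: "finite B" and \<beta>: "\<And>b. b \<in> B \<Longrightarrow> \<beta> b \<in> span B"
      "\<And>b c. b \<in> B \<Longrightarrow> c \<in> B \<Longrightarrow> \<beta> b \<bullet> c = (if b = c then 1 else 0)"
  shows "span (\<beta> ` B) = span B"
proof
  show sub: "span (\<beta> ` B) \<subseteq> span B" using \<beta>(1) by (intro span_minimal) auto
  show "span B \<subseteq> span (\<beta> ` B)"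
  proof
    fix x assume x: "x \<in> span B"
    obtain y z where yz: "y \<in> span (\<beta> ` B)" "\<And>w. w \<in> span (\<beta> ` B) \<Longrightarrow> orthogonal z w" "x = y + z"
      by (rule orthogonal_subspace_decomp_exists[of "\<beta> ` B" x]) blast
    have "x - y \<in> span B" using x yz(1) sub by (intro span_diff) auto
    then have "z \<in> span B" using yz(3) by simp
    moreover have "z \<bullet> \<beta> b = 0" if "b \<in> B" for b
      using yz(2)[of "\<beta> b"] that by (simp add: orthogonal_def span_base)
    ultimately have "z = 0"
      using dual_basis_expand[OF B, of \<beta> z] \<beta>(2) by simp
    then show "x \<in> span (\<beta> ` B)" using yz by simp
  qed
qed

lemma dual_basis_inner_Ints:
  fixes B :: "'a::euclidean_space set"
  assumes \<beta>: "\<And>b c. b \<in> B \<Longrightarrow> c \<in> B \<Longrightarrow> \<beta> b \<bullet> c = (if b = c then 1 else 0)"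
    and b: "b \<in> B" and x: "x \<in> int_span B"
  shows "\<beta> b \<bullet> x \<in> \<int>"
proof -
  obtain z :: "'a \<Rightarrow> int" where "x = (\<Sum>c\<in>B. of_int (z c) *\<^sub>R c)"
    using x by (auto simp: int_span_def)
  then have "\<beta> b \<bullet> x = (\<Sum>c\<in>B. of_int (z c) * (\<beta> b \<bullet> c))"
    by (simp add: inner_sum_right)
  also have "\<dots> \<in> \<int>"
    using \<beta>[OF b] by (intro Ints_sum) auto
  finally show ?thesis .
qed

lemma discrete_subgroup_int_span:
  fixes B :: "'a::euclidean_space set"
  assumes B: "finite B" "independent B"
  shows "discrete_subgroup (int_span B)"
proof -
  obtain \<beta> where \<beta>: "\<And>b. b \<in> B \<Longrightarrow> \<beta> b \<in> span B"
      "\<And>b c. b \<in> B \<Longrightarrow> c \<in> B \<Longrightarrow> \<beta> b \<bullet> c = (if b = c then 1 else 0)"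
    using dual_basis_exists[OF B(2)] by blast
  show ?thesis
  proof (rule discrete_subgroupI[of "\<beta> ` B"])
    show "finite (\<beta> ` B)" using B by simp
    show "int_span B \<subseteq> span (\<beta> ` B)"
      using dual_basis_span[OF B(1) \<beta>] span_int_span[OF B(1)] span_superset by metis
    show "d \<bullet> g \<in> \<int>" if "d \<in> int_span B" "g \<in> \<beta> ` B" for d g
      using that dual_basis_inner_Ints[of B \<beta>, OF \<beta>(2)] by (auto simp: inner_commute[of d])
    show "0 \<in> int_span B" using int_spanI[of "\<lambda>_. 0" B] by simp
    show "x - y \<in> int_span B" if xy: "x \<in> int_span B" "y \<in> int_span B" for x y
    proof -
      obtain u v where "x = (\<Sum>b\<in>B. of_int (u b) *\<^sub>R b)" "y = (\<Sum>b\<in>B. of_int (v b) *\<^sub>R b)"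
        using xy unfolding int_span_def by blast
      then have "x - y = (\<Sum>b\<in>B. of_int (u b - v b) *\<^sub>R b)"
        by (simp add: scaleR_diff_left sum_subtractf)
      then show ?thesis using int_spanI[of "\<lambda>b. u b - v b" B] by simp
    qed
  qed
qed

text \<open>The last claim is the substantial half of biduality: the dual basis belongs to the dual
  lattice, and pairing with it reads off coordinates. It later turns the first minimum of the
  lattice into a lower bound for all vectors that pair integrally with the dual lattice.\<close>

lemma dual_lattice_int_span:
  fixes B :: "'a::euclidean_space set"
  assumes B: "finite B" "independent B"
  shows "discrete_subgroup (dual_lattice (int_span B))"
    and "span (dual_lattice (int_span B)) = span B"
    and "\<And>x. x \<in> span B \<Longrightarrow> (\<And>d. d \<in> dual_lattice (int_span B) \<Longrightarrow> x \<bullet> d \<in> \<int>) \<Longrightarrow> x \<in> int_span B"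
proof -
  let ?D = "dual_lattice (int_span B)"
  obtain \<beta> where \<beta>: "\<And>b. b \<in> B \<Longrightarrow> \<beta> b \<in> span B"
      "\<And>b c. b \<in> B \<Longrightarrow> c \<in> B \<Longrightarrow> \<beta> b \<bullet> c = (if b = c then 1 else 0)"
    using dual_basis_exists[OF B(2)] by blast
  have D: "?D = {u \<in> span B. \<forall>v\<in>int_span B. u \<bullet> v \<in> \<int>}"
    by (simp add: dual_lattice_def span_int_span[OF B(1)])
  have \<beta>D: "\<beta> b \<in> ?D" if "b \<in> B" for b
    using \<beta>(1)[OF that] dual_basis_inner_Ints[of B \<beta>, OF \<beta>(2) that] unfolding D by blast
  show "discrete_subgroup ?D"
  proof (rule discrete_subgroupI[OF B(1)])
    show "d \<bullet> b \<in> \<int>" if "d \<in> ?D" "b \<in> B" for d b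
      using that int_span_base[OF B(1)] unfolding D by blast
  qed (auto simp: D inner_diff_left intro: span_diff span_zero)
  show "span ?D = span B"
  proof
    show "span ?D \<subseteq> span B" by (intro span_minimal) (auto simp: D)
    show "span B \<subseteq> span ?D"
      using dual_basis_span[OF B(1) \<beta>] span_mono[of "\<beta> ` B" ?D] \<beta>D by blast
  qed
  fix x assume x: "x \<in> span B" and int: "\<And>d. d \<in> ?D \<Longrightarrow> x \<bullet> d \<in> \<int>"
  have "x = (\<Sum>b\<in>B. (x \<bullet> \<beta> b) *\<^sub>R b)" by (rule dual_basis_expand[OF B(1) \<beta>(2) x])
  also have "\<dots> = (\<Sum>b\<in>B. of_int \<lfloor>x \<bullet> \<beta> b\<rfloor> *\<^sub>R b)"
    using int \<beta>D by (intro sum.cong) auto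
  also have "\<dots> \<in> int_span B" by (rule int_spanI)
  finally show "x \<in> int_span B" .
qed

section \<open>Minkowski's theorem on linear forms\<close>

text \<open>The library's formula for the measure of a linear image needs a well-ordered index
  type; this is a copy of an arbitrary finite type with such an order.\<close>

typedef 'm coord = "{..<CARD('m::finite)}"
  by (auto intro: exI[of _ 0])

instantiation coord :: (finite) wellorder
begin

definition less_eq_coord :: "'a coord \<Rightarrow> 'a coord \<Rightarrow> bool" where
  "less_eq_coord i j \<longleftrightarrow> Rep_coord i \<le> Rep_coord j"

definition less_coord :: "'a coord \<Rightarrow> 'a coord \<Rightarrow> bool" where
  "less_coord i j \<longleftrightarrow> Rep_coord i < Rep_coord j"

instance
proof
  fix x y z :: "'a coord"
  show "x < y \<longleftrightarrow> x \<le> y \<and> \<not> y \<le> x" "x \<le> x" "x \<le> y \<or> y \<le> x"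
    by (auto simp: less_eq_coord_def less_coord_def)
  show "x \<le> z" if "x \<le> y" "y \<le> z"
    using that by (simp add: less_eq_coord_def)
  show "x = y" if "x \<le> y" "y \<le> x"
  proof -
    have "Rep_coord x = Rep_coord y"
      using that unfolding less_eq_coord_def by (rule order_antisym)
    then show ?thesis by (simp add: Rep_coord_inject)
  qed
next
  fix P :: "'a coord \<Rightarrow> bool" and a
  assume step: "\<And>x. (\<And>y. y < x \<Longrightarrow> P y) \<Longrightarrow> P x"
  show "P a"
  proof (induction "Rep_coord a" arbitrary: a rule: less_induct)
    case less
    then show ?case by (rule step) (simp add: less_coord_def)
  qed
qed

end

lemma UNIV_coord: "(UNIV :: 'm::finite coord set) = Abs_coord ` {..<CARD('m)}"
  using type_definition.Abs_image[OF type_definition_coord] by metis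

instance coord :: (finite) finite
  by standard (simp add: UNIV_coord)

lemma card_coord: "CARD('m::finite coord) = CARD('m)"
  using type_definition.card[OF type_definition_coord] by simp

text \<open>Cut \<open>S\<close> along the half-open unit cubes with integer corners and translate
  all pieces into one cube. If no two points differed by an integer vector, the translates would
  stay disjoint and their total measure could not exceed 1.\<close>

lemma blichfeldt:
  fixes S :: "(real^'n) set"
  assumes S: "S \<in> lmeasurable" "bounded S" and gt: "measure lebesgue S > 1"
  shows "\<exists>s\<in>S. \<exists>t\<in>S. s \<noteq> t \<and> (\<forall>i. (s - t) $ i \<in> \<int>)"
proof (rule ccontr)
  assume no: "\<not> ?thesis"
  define Q where "Q = (\<lambda>z::real^'n. {x::real^'n. \<forall>i. z $ i \<le> x $ i \<and> x $ i < z $ i + 1})"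
  define fl where "fl = (\<lambda>x::real^'n. \<chi> i. of_int \<lfloor>x $ i\<rfloor> :: real^'n)"
  define T where "T = fl ` S"
  have QT: "x \<in> Q (fl x)" for x
    by (simp add: Q_def fl_def)
  obtain B where B: "\<And>x. x \<in> S \<Longrightarrow> norm x \<le> B"
    using S(2) by (auto simp: bounded_iff)
  have finT: "finite T"
  proof -
    have "T \<subseteq> {z. \<forall>i. z $ i \<in> of_int ` {\<lfloor>- B\<rfloor>..\<lfloor>B\<rfloor>}}"
    proof (clarsimp simp: T_def fl_def)
      fix x i assume "x \<in> S"
      then have "\<bar>x $ i\<bar> \<le> B" using B component_le_norm_cart order_trans by blast
      then show "(of_int \<lfloor>x $ i\<rfloor> :: real) \<in> of_int ` {\<lfloor>- B\<rfloor>..\<lfloor>B\<rfloor>}"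
        by (intro imageI) (auto intro!: floor_mono)
    qed
    moreover have "finite {z :: real^'n. \<forall>i. z $ i \<in> of_int ` {\<lfloor>- B\<rfloor>..\<lfloor>B\<rfloor>}}"
    proof (rule finite_subset)
      let ?F = "PiE UNIV (\<lambda>_::'n. (of_int ` {\<lfloor>- B\<rfloor>..\<lfloor>B\<rfloor>} :: real set))"
      show "{z :: real^'n. \<forall>i. z $ i \<in> of_int ` {\<lfloor>- B\<rfloor>..\<lfloor>B\<rfloor>}} \<subseteq> (\<lambda>f. \<chi> i. f i) ` ?F"
      proof
        fix z :: "real^'n" assume "z \<in> {z. \<forall>i. z $ i \<in> of_int ` {\<lfloor>- B\<rfloor>..\<lfloor>B\<rfloor>}}"
        then show "z \<in> (\<lambda>f. \<chi> i. f i) ` ?F"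
          by (intro image_eqI[of _ _ "($) z"]) auto
      qed
      show "finite ((\<lambda>f. \<chi> i. f i) ` ?F :: (real^'n) set)"
        by (intro finite_imageI finite_PiE) auto
    qed
    ultimately show ?thesis by (rule finite_subset)
  qed
  have Qm: "Q z \<in> sets lebesgue" for z
  proof -
    have "Q z = (\<Inter>i\<in>UNIV. {x. z $ i \<le> x $ i} \<inter> {x. x $ i < z $ i + 1})"
      by (auto simp: Q_def)
    also have "\<dots> \<in> sets borel"
      by (intro sets.finite_INT sets.Int borel_closed borel_open
            closed_halfspace_component_ge_cart open_halfspace_component_lt_cart) auto
    finally show ?thesis by (simp add: sets_completionI_sets)
  qed
  have Sm: "S \<inter> Q z \<in> lmeasurable" for z
    using S(1) Qm by (rule fmeasurable_Int_fmeasurable)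
  have T_int: "z $ i \<in> \<int>" if "z \<in> T" for z i
    using that by (auto simp: T_def fl_def)
  have Q_fl: "z = fl x" if "x \<in> Q z" "z \<in> T" for x z
  proof -
    have "z $ i = of_int \<lfloor>x $ i\<rfloor>" for i
      using that(1) T_int[OF that(2), of i] unfolding Q_def
      by (auto elim!: Ints_cases simp: floor_eq_iff) (metis add.commute floor_unique)
    then show ?thesis by (simp add: fl_def vec_eq_iff)
  qed
  have "S = (\<Union>z\<in>T. S \<inter> Q z)" using QT by (auto simp: T_def)
  then have "measure lebesgue S = measure lebesgue (\<Union>z\<in>T. S \<inter> Q z)" by simp
  also have "\<dots> = (\<Sum>z\<in>T. measure lebesgue (S \<inter> Q z))"
    by (rule measure_UNION'[OF finT Sm]) (auto simp: pairwise_def disjnt_def dest: Q_fl)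
  also have "\<dots> = (\<Sum>z\<in>T. measure lebesgue ((\<lambda>x. x - z) ` (S \<inter> Q z)))"
    by (simp add: measure_translation_subtract)
  also have "\<dots> = measure lebesgue (\<Union>z\<in>T. (\<lambda>x. x - z) ` (S \<inter> Q z))"
  proof (rule measure_UNION'[symmetric, OF finT])
    show "(\<lambda>x. x - z) ` (S \<inter> Q z) \<in> lmeasurable" for z
      using Sm by (rule measurable_translation_subtract)
    show "pairwise (\<lambda>i j. disjnt ((\<lambda>x. x - i) ` (S \<inter> Q i)) ((\<lambda>x. x - j) ` (S \<inter> Q j))) T"
    proof (clarsimp simp: pairwise_def disjnt_iff)
      fix z z' x y assume z: "z \<in> T" "z' \<in> T" "z \<noteq> z'" "x \<in> S" "y \<in> S" "x - z = y - z'"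
      then have eq: "x - y = z - z'" by (metis add_diff_cancel_left' add_diff_eq diff_add_cancel diff_diff_eq2)
      then have "x \<noteq> y" using z by auto
      moreover have "\<forall>i. (x - y) $ i \<in> \<int>" unfolding eq using T_int z by simp
      ultimately show False using no z by blast
    qed
  qed
  also have "\<dots> \<le> measure lebesgue (cbox 0 1 :: (real^'n) set)"
  proof (rule measure_mono_fmeasurable)
    show "(\<Union>z\<in>T. (\<lambda>x. x - z) ` (S \<inter> Q z)) \<subseteq> cbox 0 1"
      by (auto simp: Q_def mem_box_cart add.commute diff_le_eq less_imp_le)
    show "(\<Union>z\<in>T. (\<lambda>x. x - z) ` (S \<inter> Q z)) \<in> sets lebesgue"
      using finT Sm measurable_translation_subtract by (intro sets.finite_UN) blast+
  qed auto
  also have "\<dots> = 1"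
    by (subst measure_completion, simp, subst content_cbox_cart) (auto simp: interval_eq_empty_cart)
  finally show False using gt by simp
qed

text \<open>Blichfeldt is applied to the preimage under \<open>M\<close> of the box with sides
  \<open>\<rho> i\<close>, whose measure is the product of the sides divided by the absolute
  determinant. Two points of the one-sided box differ by less than \<open>\<rho> i\<close> in
  coordinate \<open>i\<close>, so no argument with a symmetric convex body is involved.\<close>

lemma minkowski_linear_forms:
  fixes M :: "real^('n::{finite,wellorder})^'n::{finite,wellorder}"
  assumes det: "det M \<noteq> 0" and \<rho>: "\<And>i. \<rho> i > 0" and less: "\<bar>det M\<bar> < (\<Prod>i\<in>UNIV. \<rho> i)"
  shows "\<exists>z::real^'n::{finite,wellorder}. z \<noteq> 0 \<and> (\<forall>i. z $ i \<in> \<int>) \<and> (\<forall>i. \<bar>(M *v z) $ i\<bar> < \<rho> i)"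
proof -
  define U :: "(real^'n::{finite,wellorder}) set" where "U = box 0 (\<chi> i. \<rho> i)"
  obtain N where MN: "M ** N = mat 1" "N ** M = mat 1"
    using det invertible_det_nz[of M] unfolding invertible_def by blast
  have detN: "det M * det N = 1"
    by (metis MN(1) det_I det_mul)
  define S where "S = (*v) N ` U"
  have mU: "measure lebesgue U = (\<Prod>i\<in>UNIV. \<rho> i)"
  proof -
    have "measure lebesgue U = measure lebesgue (cbox 0 (\<chi> i. \<rho> i) :: (real^'n::{finite,wellorder}) set)"
      unfolding U_def by (simp add: measure_def emeasure_lborel_cbox_eq emeasure_lborel_box_eq)
    also have "\<dots> = (\<Prod>i\<in>UNIV. \<rho> i)"
      using \<rho> by (subst measure_completion, simp, subst content_cbox_cart)
        (auto simp: interval_eq_empty_cart less_imp_le not_less)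
    finally show ?thesis .
  qed
  have Um: "U \<in> lmeasurable" by (simp add: U_def)
  have lin: "linear ((*v) N)" by simp
  have "measure lebesgue S = \<bar>det N\<bar> * measure lebesgue U"
    unfolding S_def using measure_linear_image[OF lin Um] by simp
  then have "measure lebesgue S > 1"
  proof -
    have "1 = \<bar>det N\<bar> * \<bar>det M\<bar>" using detN by (metis abs_mult abs_one mult.commute)
    also have "\<dots> < \<bar>det N\<bar> * measure lebesgue U"
      using less detN mU by (intro mult_strict_left_mono) auto
    finally show ?thesis using \<open>measure lebesgue S = _\<close> by simp
  qed
  moreover have "S \<in> lmeasurable"
    unfolding S_def by (rule measurable_linear_image[OF lin Um])
  moreover have "bounded S"
    unfolding S_def U_def by (intro bounded_linear_image linear_conv_bounded_linear[THEN iffD1] lin bounded_box)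
  ultimately obtain s t where st: "s \<in> S" "t \<in> S" "s \<noteq> t" "\<forall>i. (s - t) $ i \<in> \<int>"
    using blichfeldt by blast
  then obtain u w where u: "u \<in> U" "s = N *v u" and w: "w \<in> U" "t = N *v w"
    unfolding S_def by auto
  have "M *v (s - t) = u - w"
    using u w MN by (simp add: matrix_vector_mult_diff_distrib matrix_vector_mul_assoc)
  moreover have "\<bar>(u - w) $ i\<bar> < \<rho> i" for i
  proof -
    have "0 < u $ i" "u $ i < \<rho> i" "0 < w $ i" "w $ i < \<rho> i"
      using u(1) w(1) by (simp_all add: U_def mem_box_cart)
    then show ?thesis by (simp add: abs_less_iff)
  qed
  ultimately show ?thesis using st by (intro exI[of _ "s - t"]) simp
qed

section \<open>Short dual vectors\<close>

text \<open>The vectors indexed by \<open>I\<close> may span a proper subspace, while Minkowski's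
  theorem takes a square matrix; the other indices pad it. The factor \<open>sqrt (card I)\<close>
  comes from summing the squares of \<open>card I\<close> forms, each below
  \<open>r\<close>.\<close>

lemma short_combination:
  fixes F h :: "'m::finite coord \<Rightarrow> real^'m"
  assumes I: "I \<noteq> {}"
    and norm: "\<And>x. x \<in> span (F ` I) \<Longrightarrow> (norm x)\<^sup>2 = (\<Sum>i\<in>I. (h i \<bullet> x)\<^sup>2)"
    and off: "\<And>i j. i \<notin> I \<Longrightarrow> h i \<bullet> F j = (if i = j then 1 else 0)"
    and det: "det (\<chi> i j. h i \<bullet> F j) \<noteq> 0"
    and r: "r > 0" "\<bar>det (\<chi> i j. h i \<bullet> F j)\<bar> < r ^ card I"
  shows "\<exists>z :: 'm coord \<Rightarrow> int. (\<exists>i\<in>I. z i \<noteq> 0) \<and>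
           norm (\<Sum>j\<in>I. of_int (z j) *\<^sub>R F j) < sqrt (card I) * r"
proof -
  define M :: "real^'m coord^'m coord" where "M = (\<chi> i j. h i \<bullet> F j)"
  \<comment> \<open>Off \<open>I\<close> the form is the coordinate of \<open>x\<close> itself, so
    the bound 1 forces that integer to be 0, and its factor leaves the product of the bounds at
    \<open>r ^ card I\<close>.\<close>
  define \<rho> where "\<rho> = (\<lambda>i. if i \<in> I then r else 1)"
  have "(\<Prod>i\<in>UNIV. \<rho> i) = r ^ card I"
  proof -
    have "(\<Prod>i\<in>UNIV. \<rho> i) = (\<Prod>i\<in>I. \<rho> i)"
      by (rule prod.mono_neutral_right) (auto simp: \<rho>_def)
    then show ?thesis by (simp add: \<rho>_def)
  qed
  moreover have "\<rho> i > 0" for i using r by (simp add: \<rho>_def)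
  ultimately obtain x :: "real^'m coord" where x: "x \<noteq> 0" "\<forall>i. x $ i \<in> \<int>" "\<forall>i. \<bar>(M *v x) $ i\<bar> < \<rho> i"
    using minkowski_linear_forms[of M \<rho>] det r(2) by (auto simp: M_def)
  define z :: "'m coord \<Rightarrow> int" where "z = (\<lambda>i. \<lfloor>x $ i\<rfloor>)"
  have z: "of_int (z i) = x $ i" for i
    using x(2) by (simp add: z_def)
  have Mx: "(M *v x) $ i = h i \<bullet> (\<Sum>j\<in>UNIV. x $ j *\<^sub>R F j)" for i
    by (simp add: M_def matrix_vector_mult_def inner_sum_right mult.commute)
  have z0: "z i = 0" if i: "i \<notin> I" for i
  proof -
    have "h i \<bullet> (\<Sum>j\<in>UNIV. x $ j *\<^sub>R F j) = (\<Sum>j\<in>UNIV. if i = j then x $ j else 0)"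
      unfolding inner_sum_right using off[OF i] by (intro sum.cong) auto
    then have "(M *v x) $ i = x $ i" by (simp add: Mx)
    then have "\<bar>real_of_int (z i)\<bar> < 1"
      using x(3) i by (metis \<rho>_def z)
    then show ?thesis by linarith
  qed
  define s where "s = (\<Sum>j\<in>I. of_int (z j) *\<^sub>R F j)"
  have s: "s = (\<Sum>j\<in>UNIV. x $ j *\<^sub>R F j)"
    unfolding s_def by (rule sum.mono_neutral_cong_left) (auto simp: z z0 simp flip: z)
  have "s \<in> span (F ` I)" unfolding s_def by (intro span_sum span_scale span_base) auto
  then have "(norm s)\<^sup>2 = (\<Sum>i\<in>I. (h i \<bullet> s)\<^sup>2)" by (rule norm)
  also have "\<dots> < (\<Sum>i\<in>I. r\<^sup>2)"
  proof (rule sum_strict_mono)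
    fix i assume i: "i \<in> I"
    have "\<bar>h i \<bullet> s\<bar> < r" using x(3) i unfolding Mx s[symmetric] \<rho>_def by metis
    then show "(h i \<bullet> s)\<^sup>2 < r\<^sup>2" by (metis abs_ge_zero power2_abs power2_less_imp_less power_strict_mono zero_less_numeral)
  qed (use I in auto)
  also have "\<dots> = (sqrt (card I) * r)\<^sup>2" by (simp add: power_mult_distrib)
  finally have "norm s < sqrt (card I) * r"
    using r(1) by (intro power2_less_imp_less[of "norm s"]) auto
  moreover have "\<exists>i\<in>I. z i \<noteq> 0"
  proof (rule ccontr)
    assume "\<not> ?thesis"
    then have "x $ i = 0" for i using z0 z by (metis of_int_0)
    then show False using x(1) by (simp add: vec_eq_iff)
  qed
  ultimately show ?thesis unfolding s_def by blast
qed

text \<open>\<open>h\<close> enumerates orthonormal bases of \<open>span B\<close> and of its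
  orthogonal complement together. \<open>I\<close> marks the indices of the first kind and also
  indexes \<open>B\<close>, so that both \<open>B\<close> and its dual basis can be completed to
  square matrices by the same vectors.\<close>

lemma orthonormal_adapted_frame:
  fixes B :: "(real^'m::finite) set"
  assumes B: "independent B"
  obtains f :: "'m coord \<Rightarrow> real^'m" and I and h :: "'m coord \<Rightarrow> real^'m" where
    "bij_betw f I B"
    "\<forall>x. x = (\<Sum>i\<in>UNIV. (x \<bullet> h i) *\<^sub>R h i)"
    "\<forall>x\<in>span B. (norm x)\<^sup>2 = (\<Sum>i\<in>I. (h i \<bullet> x)\<^sup>2)"
    "\<forall>i\<in>-I. \<forall>x\<in>span B. h i \<bullet> x = 0"
    "\<forall>i\<in>-I. \<forall>j\<in>-I. h i \<bullet> h j = (if i = j then 1 else 0)"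
proof -
  define S where "S = span B"
  define S' where "S' = {y. \<forall>x\<in>S. orthogonal x y}"
  have subS: "subspace S" by (simp add: S_def)
  have subS': "subspace S'"
    unfolding S'_def subspace_def by (auto simp: orthogonal_clauses)
  obtain E where E: "E \<subseteq> S" "pairwise orthogonal E" "\<And>x. x \<in> E \<Longrightarrow> norm x = 1"
      "independent E" "card E = dim S" "span E = S"
    using orthonormal_basis_subspace[OF subS] by blast
  obtain C where C: "C \<subseteq> S'" "pairwise orthogonal C" "\<And>x. x \<in> C \<Longrightarrow> norm x = 1"
      "independent C" "card C = dim S'" "span C = S'"
    using orthonormal_basis_subspace[OF subS'] by blast
  have fin: "finite B" "finite E" "finite C" using B E(4) C(4) by (auto intro: finiteI_independent)
  have cardB: "card B = card E" using B E(5) unfolding S_def by (metis dim_span_eq_card_independent)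
  have orth: "orthogonal x y" if "x \<in> S" "y \<in> S'" for x y using that by (auto simp: S'_def)
  have disj: "E \<inter> C = {}" "B \<inter> C = {}"
  proof -
    have "x \<notin> S" if "x \<in> C" for x
      using orth[of x x] that C(1) C(3)[OF that] by (auto simp: orthogonal_self)
    moreover have "B \<subseteq> S" by (simp add: S_def span_superset)
    ultimately show "E \<inter> C = {}" "B \<inter> C = {}" using E(1) by auto
  qed
  have "dim S' + dim S = CARD('m)"
    using dim_subspace_orthogonal_to_vectors[OF subS subspace_UNIV] by (simp add: S'_def)
  then have cEC: "card (E \<union> C) = CARD('m coord)"
    using E(5) C(5) disj fin by (simp add: card_Un_disjoint card_coord)
  obtain h where h: "bij_betw h (UNIV :: 'm coord set) (E \<union> C)"
    using finite_same_card_bij[of "UNIV :: 'm coord set" "E \<union> C"] cEC fin by auto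
  define I where "I = {i. h i \<in> E}"
  have hI: "bij_betw h I E"
    using h unfolding I_def bij_betw_def by (auto intro: inj_on_subset)
  obtain e where e: "bij_betw e E B" using finite_same_card_bij[of E B] cardB fin by auto
  have hIc: "h i \<in> C" if "i \<notin> I" for i
    using h that by (auto simp: bij_betw_def I_def)
  have pw: "pairwise orthogonal (E \<union> C)"
  proof -
    have "orthogonal x y" "orthogonal y x" if "x \<in> E" "y \<in> C" for x y
      using orth[of x y] that E(1) C(1) by (auto simp: orthogonal_commute)
    then show ?thesis using E(2) C(2) unfolding pairwise_def by blast
  qed
  have nrm: "norm x = 1" if "x \<in> E \<union> C" for x using E(3) C(3) that by auto
  have sp: "x \<in> span (E \<union> C)" for x
  proof -
    obtain y z where yz: "y \<in> span S" "\<And>w. w \<in> span S \<Longrightarrow> orthogonal z w" "x = y + z"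
      by (rule orthogonal_subspace_decomp_exists[of S x]) blast
    have "y \<in> span E" using yz(1) E(6) by (metis span_span)
    moreover have "z \<in> span C"
      unfolding C(6) S'_def using yz(2) span_base by (auto simp: orthogonal_commute)
    ultimately show ?thesis
      using yz(3) span_mono[of E "E \<union> C"] span_mono[of C "E \<union> C"] by (auto intro!: span_add)
  qed
  have expand: "x = (\<Sum>i\<in>UNIV. (x \<bullet> h i) *\<^sub>R h i)" for x
  proof -
    have "x = (\<Sum>v\<in>E \<union> C. (x \<bullet> v) *\<^sub>R v)"
      using orthonormal_basis_expand[OF pw nrm sp] fin by simp
    also have "\<dots> = (\<Sum>i\<in>UNIV. (x \<bullet> h i) *\<^sub>R h i)"
      using sum.reindex_bij_betw[OF h, of "\<lambda>v. (x \<bullet> v) *\<^sub>R v"] by simp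
    finally show ?thesis .
  qed
  have off0: "h i \<bullet> x = 0" if "i \<notin> I" "x \<in> span B" for i x
    using orth[of x "h i"] hIc[OF that(1)] C(1) that(2)
    by (auto simp: S_def orthogonal_def inner_commute)
  have normS: "(norm x)\<^sup>2 = (\<Sum>i\<in>I. (h i \<bullet> x)\<^sup>2)" if "x \<in> span B" for x
  proof -
    have "(norm x)\<^sup>2 = x \<bullet> x" by (simp add: power2_norm_eq_inner)
    also have "\<dots> = x \<bullet> (\<Sum>i\<in>UNIV. (x \<bullet> h i) *\<^sub>R h i)" using expand[of x] by simp
    also have "\<dots> = (\<Sum>i\<in>UNIV. (h i \<bullet> x)\<^sup>2)"
      unfolding inner_sum_right by (simp add: power2_eq_square inner_commute)
    also have "\<dots> = (\<Sum>i\<in>I. (h i \<bullet> x)\<^sup>2)"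
      by (rule sum.mono_neutral_right) (auto simp: off0 that)
    finally show ?thesis .
  qed
  have offC: "h i \<bullet> h j = (if i = j then 1 else 0)" if "i \<notin> I" "j \<notin> I" for i j
  proof (cases "i = j")
    case True
    then show ?thesis using C(3)[OF hIc[OF that(1)]] by (simp add: norm_eq_1)
  next
    case False
    then have "h i \<noteq> h j" using h by (auto simp: bij_betw_def inj_def)
    then show ?thesis using C(2) hIc that False by (auto simp: pairwise_def orthogonal_def)
  qed
  show ?thesis
    by (rule that[OF bij_betw_trans[OF hI e]]) (use expand normS off0 offC in auto)
qed

text \<open>Minkowski's theorem is applied to the lattice and to its dual at once: the two
  determinants are inverse to each other, so no upper bound on the covolume is needed.\<close>

lemma shortest_vector_transference:
  fixes D :: "(real^'m::finite) set"
  assumes D: "discrete_subgroup D" and \<mu>: "\<mu> > 0"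
    and dual: "\<forall>x\<in>span D. x \<noteq> 0 \<longrightarrow> (\<forall>d\<in>D. x \<bullet> d \<in> \<int>) \<longrightarrow> \<mu> \<le> norm x"
    and w: "w \<in> D" "w \<noteq> 0" and short: "\<forall>y\<in>D. y \<noteq> 0 \<longrightarrow> norm w \<le> norm y"
  shows "norm w * \<mu> \<le> dim D"
proof (rule ccontr)
  assume not: "\<not> norm w * \<mu> \<le> dim D"
  obtain B where B: "finite B" "independent B" "D = int_span B"
    using discrete_subgroup_basis[OF D] by blast
  have spanD: "span D = span B" using span_int_span[OF B(1)] B(3) by simp
  define n where "n = card B"
  have dimD: "dim D = n"
    using spanD B(2) by (metis dim_span dim_span_eq_card_independent n_def)
  have "B \<noteq> {}" using w B(3) by (auto simp: int_span_def)
  then have n: "n > 0" using B(1) by (simp add: n_def card_gt_0_iff)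
  obtain \<beta> where \<beta>: "\<And>b. b \<in> B \<Longrightarrow> \<beta> b \<in> span B"
      "\<And>b c. b \<in> B \<Longrightarrow> c \<in> B \<Longrightarrow> \<beta> b \<bullet> c = (if b = c then 1 else 0)"
    using dual_basis_exists[OF B(2)] by blast
  obtain f :: "'m coord \<Rightarrow> real^'m" and I and h :: "'m coord \<Rightarrow> real^'m" where f: "bij_betw f I B"
    and frame: "\<forall>x. x = (\<Sum>i\<in>UNIV. (x \<bullet> h i) *\<^sub>R h i)"
      "\<forall>x\<in>span B. (norm x)\<^sup>2 = (\<Sum>i\<in>I. (h i \<bullet> x)\<^sup>2)"
      "\<forall>i\<in>-I. \<forall>x\<in>span B. h i \<bullet> x = 0"
      "\<forall>i\<in>-I. \<forall>j\<in>-I. h i \<bullet> h j = (if i = j then 1 else 0)"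
    using orthonormal_adapted_frame[OF B(2)] .
  note expand = frame(1)[rule_format] and normS = frame(2)[rule_format]
  have off0: "h i \<bullet> x = 0" if "i \<notin> I" "x \<in> span B" for i x
    using frame(3) that by blast
  have offC: "h i \<bullet> h j = (if i = j then 1 else 0)" if "i \<notin> I" "j \<notin> I" for i j
    using frame(4) that by blast
  have cardI: "card I = n" using bij_betw_same_card[OF f] by (simp add: n_def)
  have Ine: "I \<noteq> {}" using cardI n by auto
  have fB: "f i \<in> B" if "i \<in> I" for i using f that by (auto simp: bij_betw_def)
  \<comment> \<open>\<open>B\<close> and its dual basis, padded by the same orthonormal vectors,
    remain dual families. Their coordinate matrices in the frame therefore have determinants with
    product 1.\<close>
  define F where "F = (\<lambda>i. if i \<in> I then f i else h i)"
  define G where "G = (\<lambda>i. if i \<in> I then \<beta> (f i) else h i)"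
  have F_span: "F i \<in> span B" and G_span: "G i \<in> span B" if "i \<in> I" for i
    using that fB \<beta>(1) by (auto simp: F_def G_def span_base)
  define M :: "real^'m coord^'m coord" where "M = (\<chi> i j. h i \<bullet> F j)"
  define N :: "real^'m coord^'m coord" where "N = (\<chi> i j. h i \<bullet> G j)"
  have FG: "F j \<bullet> G k = (if j = k then 1 else 0)" for j k
  proof (cases "j \<in> I"; cases "k \<in> I")
    assume "j \<in> I" "k \<in> I"
    moreover from this have "f j = f k \<longleftrightarrow> j = k" using f by (auto simp: bij_betw_def inj_on_def)
    ultimately show ?thesis
      using \<beta>(2)[OF fB fB, of k j] by (auto simp: F_def G_def inner_commute)
  next
    assume "j \<in> I" "k \<notin> I"
    then show ?thesis using off0[OF _ F_span, of k j] by (auto simp: G_def inner_commute)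
  next
    assume "j \<notin> I" "k \<in> I"
    then show ?thesis using off0[OF _ G_span, of j k] by (auto simp: F_def)
  next
    assume "j \<notin> I" "k \<notin> I"
    then show ?thesis using offC by (auto simp: F_def G_def)
  qed
  have "transpose M ** N = mat 1"
  proof -
    have "(\<Sum>i\<in>UNIV. (h i \<bullet> F j) * (h i \<bullet> G k)) = F j \<bullet> G k" for j k
    proof -
      have "F j \<bullet> G k = (\<Sum>i\<in>UNIV. (F j \<bullet> h i) *\<^sub>R h i) \<bullet> G k" using expand[of "F j"] by simp
      also have "\<dots> = (\<Sum>i\<in>UNIV. (h i \<bullet> F j) * (h i \<bullet> G k))"
        by (simp add: inner_sum_left inner_commute[of "F j"])
      finally show ?thesis by simp
    qed
    then show ?thesis
      by (simp add: vec_eq_iff matrix_matrix_mult_def transpose_def M_def N_def mat_def FG)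
  qed
  then have detMN: "det M * det N = 1" by (metis det_I det_mul det_transpose)
  \<comment> \<open>The scaling makes the bounds of \<open>short_combination\<close> equal to
    \<open>norm w\<close> and \<open>\<mu>\<close>. The negated claim says
    \<open>r1 * r2 > 1\<close>, so at least one of the two determinants is small enough: the result
    is either a vector of \<open>D\<close> shorter than \<open>w\<close> or a dual vector shorter
    than \<open>\<mu>\<close>.\<close>
  define r1 where "r1 = norm w / sqrt n"
  define r2 where "r2 = \<mu> / sqrt n"
  have r: "r1 > 0" "r2 > 0" using w \<mu> n by (auto simp: r1_def r2_def)
  have "r1 * r2 > 1" using not n dimD by (simp add: r1_def r2_def field_simps)
  then have "\<bar>det M\<bar> * \<bar>det N\<bar> < r1 ^ n * r2 ^ n"
    using n by (simp add: detMN flip: abs_mult power_mult_distrib)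
  then consider "\<bar>det M\<bar> < r1 ^ n" | "\<bar>det N\<bar> < r2 ^ n"
    using r by (meson abs_ge_zero linorder_not_less mult_mono zero_le_power less_imp_le order_trans)
  then show False
  proof cases
    case 1
    obtain z :: "'m coord \<Rightarrow> int" where z: "\<exists>i\<in>I. z i \<noteq> 0"
      and lt: "norm (\<Sum>j\<in>I. of_int (z j) *\<^sub>R F j) < sqrt (card I) * r1"
    proof (rule exE[OF short_combination[of I F h r1]])
      show "(norm x)\<^sup>2 = (\<Sum>i\<in>I. (h i \<bullet> x)\<^sup>2)" if "x \<in> span (F ` I)" for x
        using that F_span span_minimal[of "F ` I" "span B"] normS by blast
      show "h i \<bullet> F j = (if i = j then 1 else 0)" if "i \<notin> I" for i j
        using that off0[OF that F_span, of j] offC[OF that, of j] by (auto simp: F_def)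
    qed (use Ine detMN r 1 cardI in \<open>auto simp: M_def\<close>)
    define s where "s = (\<Sum>j\<in>I. of_int (z j) *\<^sub>R F j)"
    have "s \<bullet> G k = of_int (z k)" if "k \<in> I" for k
    proof -
      have "s \<bullet> G k = (\<Sum>j\<in>I. if k = j then of_int (z j) else 0)"
        unfolding s_def inner_sum_left by (intro sum.cong) (auto simp: FG)
      then show ?thesis using that by simp
    qed
    then have "s \<noteq> 0" using z by (metis inner_zero_left of_int_eq_0_iff)
    moreover have "s \<in> D"
    proof -
      have "F i \<in> D" if "i \<in> I" for i
        using int_span_base[OF B(1) fB[OF that]] B(3) that by (simp add: F_def)
      then show ?thesis unfolding s_def by (rule discrete_subgroup_int_combination[OF D])
    qed
    ultimately have "norm w \<le> norm s" using short by blast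
    then show False using lt n by (simp add: s_def r1_def cardI)
  next
    case 2
    obtain z :: "'m coord \<Rightarrow> int" where z: "\<exists>i\<in>I. z i \<noteq> 0"
      and lt: "norm (\<Sum>j\<in>I. of_int (z j) *\<^sub>R G j) < sqrt (card I) * r2"
    proof (rule exE[OF short_combination[of I G h r2]])
      show "(norm x)\<^sup>2 = (\<Sum>i\<in>I. (h i \<bullet> x)\<^sup>2)" if "x \<in> span (G ` I)" for x
        using that G_span span_minimal[of "G ` I" "span B"] normS by blast
      show "h i \<bullet> G j = (if i = j then 1 else 0)" if "i \<notin> I" for i j
        using that off0[OF that G_span, of j] offC[OF that, of j] by (auto simp: G_def)
    qed (use Ine detMN r 2 cardI in \<open>auto simp: N_def\<close>)
    define s where "s = (\<Sum>j\<in>I. of_int (z j) *\<^sub>R G j)"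
    have sF: "s \<bullet> F k = of_int (z k)" if "k \<in> I" for k
    proof -
      have "s \<bullet> F k = (\<Sum>j\<in>I. if k = j then of_int (z j) else 0)"
        unfolding s_def inner_sum_left
        by (intro sum.cong) (auto simp: FG inner_commute[of "G _" "F k"])
      then show ?thesis using that by simp
    qed
    then have "s \<noteq> 0" using z by (metis inner_zero_left of_int_eq_0_iff)
    moreover have "s \<in> span D"
      unfolding s_def spanD using G_span by (intro span_sum span_scale)
    moreover have "s \<bullet> d \<in> \<int>" if "d \<in> D" for d
    proof -
      have "s \<bullet> b \<in> \<int>" if "b \<in> B" for b
      proof -
        obtain k where "k \<in> I" "b = f k" using f \<open>b \<in> B\<close> by (auto simp: bij_betw_def)
        then show ?thesis using sF[of k] by (simp add: F_def)
      qed
      moreover obtain u :: "real^'m \<Rightarrow> int" where "d = (\<Sum>b\<in>B. of_int (u b) *\<^sub>R b)"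
        using \<open>d \<in> D\<close> B(3) by (auto simp: int_span_def)
      ultimately show ?thesis by (auto simp: inner_sum_right intro!: Ints_sum)
    qed
    ultimately have "\<mu> \<le> norm s" using dual by blast
    then show False using lt n by (simp add: s_def r2_def cardI)
  qed
qed

text \<open>The quadratic bound pays for lifting. In units of 1 / \<mu>, undoing one projection adds
  half the length of \<open>w\<close>, at most (n + 1) / 2, and n^2 + (n + 1) / 2 is at most (n +
  1)^2.\<close>

lemma short_independent_vectors:
  fixes D :: "(real^'m::finite) set"
  assumes "discrete_subgroup D" and \<mu>: "\<mu> > 0"
    and "\<forall>x\<in>span D. x \<noteq> 0 \<longrightarrow> (\<forall>d\<in>D. x \<bullet> d \<in> \<int>) \<longrightarrow> \<mu> \<le> norm x"
  shows "\<exists>W\<subseteq>D. finite W \<and> independent W \<and> span W = span D \<and>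
           (\<forall>w\<in>W. norm w * \<mu> \<le> (real (dim D))\<^sup>2)"
  using assms(1,3)
proof (induction "dim D" arbitrary: D)
  case 0
  then have D0: "D = {0}" by (auto simp: discrete_subgroup_def)
  show ?case
    unfolding D0 by (intro exI[of _ "{}"]) (simp add: independent_empty)
next
  case (Suc n)
  note D = Suc.prems(1)
  have "\<not> D \<subseteq> {0}" using Suc.hyps(2) by (metis dim_eq_0 nat.distinct(1))
  then obtain x where x: "x \<in> D" "x \<noteq> 0" by blast
  then obtain w where w: "w \<in> D" "w \<noteq> 0" and short: "\<forall>y\<in>D. y \<noteq> 0 \<longrightarrow> norm w \<le> norm y"
    using discrete_subgroup_shortest[OF D x] by blast
  have norm_w: "norm w * \<mu> \<le> Suc n"
    using shortest_vector_transference[OF D \<mu> Suc.prems(2) w short] Suc.hyps(2) by simp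
  let ?D = "reject w ` D"
  have n: "n = dim ?D" using dim_reject[OF w] Suc.hyps(2) by simp
  \<comment> \<open>The lower bound \<mu> survives projection unchanged: a vector in the span of the
    projection is orthogonal to \<open>w\<close>, so it pairs with \<open>d\<close> exactly as with
    \<open>reject w d\<close>.\<close>
  have dual: "\<forall>x\<in>span ?D. x \<noteq> 0 \<longrightarrow> (\<forall>d\<in>?D. x \<bullet> d \<in> \<int>) \<longrightarrow> \<mu> \<le> norm x"
  proof (intro ballI impI)
    fix x assume x: "x \<in> span ?D" "x \<noteq> 0" and int: "\<forall>d\<in>?D. x \<bullet> d \<in> \<int>"
    have "x \<in> span D"
      using x(1) span_mono[of ?D "insert w ?D"] span_insert_reject[OF w(1)] by blast
    have "orthogonal w y" if "y \<in> ?D" for y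
      using that reject_orthogonal by (auto simp: orthogonal_def inner_commute)
    then have "orthogonal w x" using x(1) by (metis orthogonal_to_span)
    then have "x \<bullet> d = x \<bullet> reject w d" for d
      by (simp add: reject_def inner_diff_right orthogonal_def inner_commute)
    then have "\<forall>d\<in>D. x \<bullet> d \<in> \<int>" using int by simp
    with \<open>x \<in> span D\<close> x(2) show "\<mu> \<le> norm x" using Suc.prems(2) by blast
  qed
  have "\<exists>W\<subseteq>?D. finite W \<and> independent W \<and> span W = span ?D \<and>
          (\<forall>w\<in>W. norm w * \<mu> \<le> (real (dim ?D))\<^sup>2)"
    using Suc.hyps(1)[OF n discrete_subgroup_reject[OF D w(1)] dual] .
  then obtain W where W: "W \<subseteq> ?D" "finite W" "independent W" "span W = span ?D"
    and norm_W: "\<And>u. u \<in> W \<Longrightarrow> norm u * \<mu> \<le> (real n)\<^sup>2"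
    using n by metis
  have "\<exists>y\<in>D. reject w y = u \<and> norm (y - u) \<le> norm w / 2" if u: "u \<in> W" for u
  proof -
    obtain x where x: "x \<in> D" "u = reject w x" using W(1) u by blast
    then show ?thesis using reject_lift[OF D w(1) x(1)] by metis
  qed
  then obtain l where l: "\<And>u. u \<in> W \<Longrightarrow> l u \<in> D \<and> reject w (l u) = u"
    and close: "\<And>u. u \<in> W \<Longrightarrow> norm (l u - u) \<le> norm w / 2" by metis
  let ?V = "insert w (l ` W)"
  have V: "independent ?V" "span ?V = span D"
    using independent_insert_lift(1,3)[OF w W(2-4) l] by auto
  have "norm v * \<mu> \<le> (real (Suc n))\<^sup>2" if v: "v \<in> ?V" for v
  proof -
    consider "v = w" | u where "u \<in> W" "v = l u" using v by blast
    then show ?thesis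
    proof cases
      case 1
      have "real (Suc n) \<le> (real (Suc n))\<^sup>2" by (simp add: power2_eq_square)
      with norm_w show ?thesis unfolding 1 by (rule order_trans)
    next
      case 2
      have "norm v \<le> norm u + norm w / 2"
        using close[OF 2(1)] norm_triangle_sub[of "l u" u] 2(2) by simp
      then have "norm v * \<mu> \<le> (norm u + norm w / 2) * \<mu>"
        using \<mu> by (intro mult_right_mono) auto
      also have "\<dots> = norm u * \<mu> + (norm w * \<mu>) / 2"
        by (simp add: algebra_simps)
      also have "\<dots> \<le> (real n)\<^sup>2 + real (Suc n) / 2"
        using norm_W[OF 2(1)] norm_w by (intro add_mono divide_right_mono) auto
      also have "\<dots> \<le> (real (Suc n))\<^sup>2"
        by (simp add: power2_eq_square algebra_simps)
      finally show ?thesis .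
    qed
  qed
  then show ?case
    using V W(2) w(1) l Suc.hyps(2) by (intro exI[of _ ?V]) auto
qed

section \<open>Successive minima\<close>

text \<open>The nonzero vector \<open>x\<close> makes the set of radii nonempty, so that its infimum
  is meaningful.\<close>

lemma successive_minimum_ge:
  assumes "x \<in> L" "x \<noteq> 0" and "\<And>y. y \<in> L \<Longrightarrow> y \<noteq> 0 \<Longrightarrow> c \<le> norm y"
  shows "c \<le> successive_minimum 1 L"
  unfolding successive_minimum_def
proof (rule cInf_greatest)
  have "\<not> L \<inter> cball 0 (norm x) \<subseteq> {0}" using assms(1,2) by auto
  then have "1 \<le> dim (span (L \<inter> cball 0 (norm x)))" by (metis One_nat_def Suc_leI dim_eq_0 dim_span neq0_conv)
  then show "{r. r > 0 \<and> dim (span (L \<inter> cball 0 r)) \<ge> 1} \<noteq> {}" using assms(2) by force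
  fix r assume "r \<in> {r. r > 0 \<and> dim (span (L \<inter> cball 0 r)) \<ge> 1}"
  then have "\<not> L \<inter> cball 0 r \<subseteq> {0}" by (metis (no_types, lifting) dim_eq_0 dim_span mem_Collect_eq not_one_le_zero)
  then obtain y where "y \<in> L \<inter> cball 0 r" "y \<noteq> 0" by blast
  then show "c \<le> r" using assms(3)[of y] by simp
qed

lemma successive_minimum_1:
  assumes "x \<in> L" "x \<noteq> 0" and "\<And>y. y \<in> L \<Longrightarrow> y \<noteq> 0 \<Longrightarrow> norm x \<le> norm y"
  shows "successive_minimum 1 L = norm x"
proof (rule antisym)
  have "\<not> L \<inter> cball 0 (norm x) \<subseteq> {0}" using assms(1,2) by auto
  then have "1 \<le> dim (span (L \<inter> cball 0 (norm x)))" by (metis One_nat_def Suc_leI dim_eq_0 dim_span neq0_conv)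
  then show "successive_minimum 1 L \<le> norm x"
    unfolding successive_minimum_def using assms(2)
    by (intro cInf_lower) (auto intro!: bdd_belowI[of _ 0])
qed (rule successive_minimum_ge[OF assms])

text \<open>The infimum need not be attained by definition, but discreteness leaves a gap above the
  shortest length. A radius inside the gap already has n independent vectors in its ball, and the
  nonzero vectors there are all shortest.\<close>

lemma dim_shortest_nonzero_vectors:
  assumes L: "discrete_subgroup L" and n: "dim L = n"
    and x: "x \<in> L" "x \<noteq> 0" "\<And>y. y \<in> L \<Longrightarrow> y \<noteq> 0 \<Longrightarrow> norm x \<le> norm y"
    and eq: "successive_minimum n L = norm x"
  shows "dim (shortest_nonzero_vectors L) = n"
proof (rule antisym)
  let ?A = "shortest_nonzero_vectors L"
  have "?A \<subseteq> L" by (auto simp: shortest_nonzero_vectors_def)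
  then show "dim ?A \<le> n" using n by (metis dim_subset)
  let ?S = "{r. r > 0 \<and> dim (span (L \<inter> cball 0 r)) \<ge> n}"
  \<comment> \<open>The lengths above the minimum, up to twice the minimum; adding
    \<open>2 * norm x\<close> keeps the set nonempty, so \<open>Min F\<close> marks the end of a
    gap.\<close>
  define F where "F = insert (2 * norm x) (norm ` (L \<inter> cball 0 (2 * norm x)) - {..norm x})"
  have F: "finite F" "F \<noteq> {}" using L by (auto simp: F_def discrete_subgroup_def)
  have "norm x < Min F" using F x(2) by (auto simp: F_def)
  moreover have "?S \<noteq> {}"
  proof -
    obtain B where B: "B \<subseteq> L" "independent B" "L \<subseteq> span B" "card B = dim L"
      using basis_exists[of L] by blast
    then have "bounded B" by (simp add: finite_imp_bounded finiteI_independent)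
    then obtain r where r: "r > 0" "\<And>b. b \<in> B \<Longrightarrow> norm b \<le> r" by (auto simp: bounded_pos)
    then have "B \<subseteq> L \<inter> cball 0 r" using B by auto
    then have "dim B \<le> dim (L \<inter> cball 0 r)" by (rule dim_subset)
    then have "r \<in> ?S" using r(1) B(2,4) n by (simp add: dim_eq_card_independent)
    then show ?thesis by blast
  qed
  ultimately obtain s where s: "s \<in> ?S" "s < Min F"
    using eq cInf_lessD[of ?S "Min F"] unfolding successive_minimum_def by auto
  have "L \<inter> cball 0 s \<subseteq> insert 0 ?A"
  proof
    fix y assume y: "y \<in> L \<inter> cball 0 s"
    show "y \<in> insert 0 ?A"
    proof (cases "y = 0")
      case False
      have "norm y \<notin> F" using y s(2) Min_le[OF F(1), of "norm y"] by auto
      moreover have "Min F \<le> 2 * norm x" using F(1) by (simp add: F_def)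
      ultimately have "norm y \<le> norm x" using y s(2) by (auto simp: F_def)
      then show ?thesis
        using y False x(3) unfolding shortest_nonzero_vectors_def by (auto intro: order_trans)
    qed simp
  qed
  then have "dim (L \<inter> cball 0 s) \<le> dim (insert 0 ?A)" by (rule dim_subset)
  then show "n \<le> dim ?A" using s(1) by (simp add: dim_insert span_zero)
qed

section \<open>Dual vectors defining a chain\<close>

theorem theorem4p2:
  fixes L :: "(real ^ 'm) set" and n :: nat
  assumes "lattice_of_rank n L"
    and "successive_minimum 1 L = successive_minimum n L"
  shows "\<exists>v \<in> dual_lattice L.
           uniquely_defines_chain v n (shortest_nonzero_vectors L) \<and>
           norm v \<le> 5 * real n powr (17 / 2) * successive_minimum 1 (dual_lattice L)"
proof (cases "n = 0")
  case True
  \<comment> \<open>In rank 0 the minimum of the dual lattice is an unspecified infimum over the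
    empty set, but its factor \<open>0 powr (17 / 2)\<close> is 0, so the zero vector meets the
    bound.\<close>
  have "0 \<in> dual_lattice L" by (simp add: dual_lattice_def span_zero)
  then show ?thesis
    using True by (intro bexI[of _ 0]) (auto simp: uniquely_defines_chain_def)
next
  case False
  obtain B where B: "finite B" "card B = n" "independent B" and L_eq: "L = int_span B"
    using assms(1) unfolding lattice_of_rank_def int_span_def by blast
  define D where "D = dual_lattice L"
  define A where "A = shortest_nonzero_vectors L"
  have spanL: "span L = span B" by (simp add: L_eq span_int_span[OF B(1)])
  have dimL: "dim L = n" using spanL B by (metis dim_span dim_span_eq_card_independent)
  have discL: "discrete_subgroup L" unfolding L_eq by (rule discrete_subgroup_int_span[OF B(1,3)])
  have "\<not> L \<subseteq> {0}" using dimL False by (metis dim_eq_0)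
  then obtain x0 where x0: "x0 \<in> L" "x0 \<noteq> 0" by blast
  then obtain s where s: "s \<in> L" "s \<noteq> 0" "\<And>y. y \<in> L \<Longrightarrow> y \<noteq> 0 \<Longrightarrow> norm s \<le> norm y"
    using discrete_subgroup_shortest[OF discL x0] by blast
  define \<mu> where "\<mu> = norm s"
  have \<mu>: "\<mu> > 0" using s by (simp add: \<mu>_def)
  \<comment> \<open>The equality of the first and last minima enters here: it makes the shortest
    vectors span.\<close>
  have dimA: "dim A = n"
    unfolding A_def using successive_minimum_1[OF s] assms(2)
    by (intro dim_shortest_nonzero_vectors[OF discL dimL s]) auto
  have AL: "A \<subseteq> L" and normA: "\<And>a. a \<in> A \<Longrightarrow> norm a = \<mu>"
    using s by (auto simp: A_def shortest_nonzero_vectors_def \<mu>_def intro: antisym)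
  have finA: "finite A"
    by (rule finite_subset[of _ "L \<inter> cball 0 \<mu>"])
      (use AL normA discL in \<open>auto simp: discrete_subgroup_def\<close>)
  have spanA: "span A = span L" using AL dimA dimL by (intro dim_eq_span) auto
  have discD: "discrete_subgroup D" and spanD: "span D = span L"
    using dual_lattice_int_span(1,2)[OF B(1,3)] by (simp_all add: D_def L_eq span_int_span[OF B(1)])
  have dimD: "dim D = n" using spanD dimL by (metis dim_span)
  have intD: "u \<bullet> x \<in> \<int>" if "u \<in> D" "x \<in> L" for u x
    using that by (simp add: D_def dual_lattice_def)
  have dual: "\<forall>x\<in>span D. x \<noteq> 0 \<longrightarrow> (\<forall>d\<in>D. x \<bullet> d \<in> \<int>) \<longrightarrow> \<mu> \<le> norm x"
  proof (intro ballI impI)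
    fix x assume x: "x \<in> span D" "x \<noteq> 0" "\<forall>d\<in>D. x \<bullet> d \<in> \<int>"
    have "x \<in> L"
      unfolding L_eq using x spanD spanL
      by (intro dual_lattice_int_span(3)[OF B(1,3)]) (auto simp: D_def L_eq)
    then show "\<mu> \<le> norm x" unfolding \<mu>_def using s(3) x(2) by blast
  qed
  obtain W where W: "W \<subseteq> D" "finite W" "independent W" "span W = span D"
    and "\<forall>w\<in>W. norm w * \<mu> \<le> (real (dim D))\<^sup>2"
    using short_independent_vectors[OF discD \<mu> dual] by (elim exE conjE) (rule that)
  then have norm_W: "norm w * \<mu> \<le> (real n)\<^sup>2" if "w \<in> W" for w
    using that dimD by simp
  have cardW: "card W = n"
    using W(3,4) dimD by (metis dim_span dim_span_eq_card_independent)
  define P where "P = weighted_sum n ` ordered_bases n A"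
  have "finite (PiE {1..n} (\<lambda>_. A))" using finA by (simp add: finite_PiE)
  then have "finite (ordered_bases n A)" by (simp add: ordered_bases_def)
  then have P: "finite P" "P \<noteq> {}"
    using ordered_bases_nonempty[OF dimA] by (auto simp: P_def)
  have P_elem: "y j \<in> A" if "y \<in> ordered_bases n A" "j \<in> {1..n}" for y j
    using that by (auto simp: ordered_bases_def)
  have "P \<subseteq> span W"
    using P_elem span_base[of _ A] unfolding W(4) spanD spanA[symmetric] P_def weighted_sum_def
    by (auto intro!: span_sum span_scale)
  moreover have "w \<bullet> p \<in> \<int>" if p: "p \<in> P" and w: "w \<in> W" for p w
  proof -
    obtain y where y: "y \<in> ordered_bases n A" "p = weighted_sum n y" using p by (auto simp: P_def)
    have "w \<bullet> y j \<in> \<int>" if "j \<in> {1..n}" for j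
      using intD P_elem[OF y(1) that] AL W(1) w by blast
    then show ?thesis
      unfolding y(2) weighted_sum_def inner_sum_right inner_scaleR_right
      by (intro Ints_sum Ints_mult Ints_of_nat)
  qed
  \<comment> \<open>One factor n^2 bounds the inner product of \<open>w\<close> with each shortest
    vector by Cauchy-Schwarz; the other comes from n weights of size at most n.\<close>
  moreover have "\<bar>w \<bullet> p\<bar> \<le> real (n ^ 4)" if p: "p \<in> P" and w: "w \<in> W" for p w
  proof -
    obtain y where y: "y \<in> ordered_bases n A" "p = weighted_sum n y" using p by (auto simp: P_def)
    have "\<bar>w \<bullet> y j\<bar> \<le> (real n)\<^sup>2" if "j \<in> {1..n}" for j
      using Cauchy_Schwarz_ineq2[of w "y j"] norm_W[OF w] normA[OF P_elem[OF y(1) that]] by simp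
    then have "\<bar>w \<bullet> p\<bar> \<le> (real n)\<^sup>2 * (real n)\<^sup>2"
      unfolding y(2) by (rule inner_weighted_sum_le)
    then show ?thesis by (simp flip: power_add)
  qed
  ultimately obtain z :: "real^'m \<Rightarrow> int" and p where
      z: "\<forall>w\<in>W. 0 \<le> z w \<and> z w \<le> int (2 * card W * n ^ 4)" and p: "p \<in> P"
      and min: "\<forall>q\<in>P. q \<noteq> p \<longrightarrow>
        (\<Sum>w\<in>W. of_int (z w) *\<^sub>R w) \<bullet> p < (\<Sum>w\<in>W. of_int (z w) *\<^sub>R w) \<bullet> q"
    using isolating_combination[OF W(2) P, of "n ^ 4"] by blast
  define v where "v = (\<Sum>w\<in>W. of_int (z w) *\<^sub>R w)"
  have "v \<in> D"
    unfolding v_def using W(1) by (intro discrete_subgroup_int_combination[OF discD]) auto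
  moreover have "uniquely_defines_chain v n A"
  proof -
    obtain y where y: "y \<in> ordered_bases n A" "p = weighted_sum n y" using p by (auto simp: P_def)
    show ?thesis
      using min y by (intro unique_weighted_sum_chain[OF dimA y(1)]) (auto simp: v_def P_def)
  qed
  moreover have "norm v \<le> 5 * real n powr (17 / 2) * successive_minimum 1 D"
  proof -
    have "norm v \<le> (\<Sum>w\<in>W. norm (of_int (z w) *\<^sub>R w))"
      unfolding v_def by (rule norm_sum)
    also have "\<dots> \<le> (\<Sum>w\<in>W. 2 * real n ^ 5 * ((real n)\<^sup>2 / \<mu>))"
    proof (rule sum_mono)
      fix w assume w: "w \<in> W"
      have "\<bar>real_of_int (z w)\<bar> \<le> real_of_int (int (2 * card W * n ^ 4))"
        using z w by (simp only: of_int_abs[symmetric] of_int_le_iff) simp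
      also have "\<dots> = 2 * real n ^ 5" by (simp add: cardW flip: power_Suc)
      finally have "\<bar>real_of_int (z w)\<bar> \<le> 2 * real n ^ 5" .
      moreover have "norm w \<le> (real n)\<^sup>2 / \<mu>" using norm_W[OF w] \<mu> by (simp add: field_simps)
      ultimately show "norm (of_int (z w) *\<^sub>R w) \<le> 2 * real n ^ 5 * ((real n)\<^sup>2 / \<mu>)"
        by (simp only: norm_scaleR) (intro mult_mono, auto)
    qed
    also have "\<dots> = 2 * real n ^ 8 * (1 / \<mu>)"
      by (simp add: cardW power2_eq_square eval_nat_numeral)
    also have "\<dots> \<le> 5 * real n powr (17 / 2) * (1 / \<mu>)"
    proof (rule mult_right_mono)
      have "real n ^ 8 = real n powr 8" using False by simp
      also have "\<dots> \<le> real n powr (17 / 2)" using False by (intro powr_mono) auto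
      moreover have "0 \<le> real n ^ 8" by simp
      ultimately show "2 * real n ^ 8 \<le> 5 * real n powr (17 / 2)" by linarith
    qed (use \<mu> in simp)
    also have "\<dots> \<le> 5 * real n powr (17 / 2) * successive_minimum 1 D"
    proof (rule mult_left_mono)
      have "\<not> D \<subseteq> {0}" using dimD False by (metis dim_eq_0)
      then obtain u where u: "u \<in> D" "u \<noteq> 0" by blast
      show "1 / \<mu> \<le> successive_minimum 1 D"
      proof (rule successive_minimum_ge[OF u])
        fix y assume y: "y \<in> D" "y \<noteq> 0"
        \<comment> \<open>\<open>y\<close> lies in the span of the shortest vectors, so it cannot be
          orthogonal to all of them. Some pairing is then a nonzero integer, and Cauchy-Schwarz
          turns it into a lower bound for \<open>norm y\<close>.\<close>
        have "\<exists>a\<in>A. y \<bullet> a \<noteq> 0"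
        proof (rule ccontr)
          assume "\<not> ?thesis"
          then have "orthogonal y a" if "a \<in> A" for a using that by (simp add: orthogonal_def)
          moreover have "y \<in> span A" using y(1) spanA spanD span_base by blast
          ultimately have "orthogonal y y" by (metis orthogonal_to_span)
          then show False using y(2) by (simp add: orthogonal_self)
        qed
        then obtain a where a: "a \<in> A" "y \<bullet> a \<noteq> 0" by blast
        then have "1 \<le> \<bar>y \<bullet> a\<bar>" using intD[OF y(1), of a] AL by (auto intro: Ints_nonzero_abs_ge1)
        also have "\<dots> \<le> norm y * \<mu>" using Cauchy_Schwarz_ineq2[of y a] normA[OF a(1)] by simp
        finally show "1 / \<mu> \<le> norm y" using \<mu> by (simp add: field_simps)
      qed
    qed simp
    finally show ?thesis .
  qed
  ultimately show ?thesis unfolding D_def A_def by blast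
qed

end
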